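(* Let $\Omega\subset\mathbb{R}^n$ be open and bounded. Then there exists a constant $C=C(n,\Omega)$ such that for all $0<s<1$, all $1<p<\infty$ and all $u\in H^{s,p}_0(\Omega)$, $$\|u\|_{L^p(\Omega)}\le\frac{C}{s}\,\|D^su\|_{L^p(\mathbb{R}^n)} .$$
   Context: For $0<s<1$ let $$c_{n,s}=(n+s-1)\frac{\Gamma\left(\frac{n+s-1}{2}\right)}{\pi^{n/2}\,2^{1-s}\,\Gamma\left(\frac{1-s}{2}\right)}.$$ For $u\in C_c^\infty(\mathbb{R}^n)$ the $s$-fractional gradient is $$D^su(x)=c_{n,s}\int_{\mathbb{R}^n}\frac{u(x)-u(y)}{|x-y|^{n+s}}\frac{x-y}{|x-y|}\,dy\in\mathbb{R}^n .$$ For $1\le p<\infty$, $H^{s,p}(\mathbb{R}^n)$ is the completion of $C_c^\infty(\mathbb{R}^n)$ under the norm $\|u\|_{L^p(\mathbb{R}^n)}+\|D^su\|_{L^p(\mathbb{R}^n)}$, i.e. the set of $u\in L^p(\mathbb{R}^n)$ for which there are $u_j\in C_c^\infty(\mathbb{R}^n)$ with $u_j\to u$ in $L^p$ and $\{D^su_j\}$ Cauchy in $L^p$; then $D^su$ is the $L^p$ limit of $D^su_j$ (independent of the sequence and of $p$). $H^{s,p}_0(\Omega)$ is the closure of $C_c^\infty(\Omega)$ (functions extended by zero) in $H^{s,p}(\mathbb{R}^n)$. *)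

theory Defs
  imports "HOL-Analysis.Analysis"
begin

primrec C_k :: "nat \<Rightarrow> ('a::euclidean_space \<Rightarrow> real) \<Rightarrow> bool" where
  "C_k 0 f \<longleftrightarrow> continuous_on UNIV f"
| "C_k (Suc k) f \<longleftrightarrow> (\<forall>x. f differentiable (at x)) \<and>
     (\<forall>b\<in>Basis. C_k k (\<lambda>x. frechet_derivative f (at x) b))"

text \<open>\<open>C\<^sub>c\<^sup>\<infinity>(\<Omega>)\<close>; its elements are regarded as functions on the whole space, extended by zero.\<close>

definition Cc_infinity :: "'a::euclidean_space set \<Rightarrow> ('a \<Rightarrow> real) set" where
  "Cc_infinity \<Omega> = {u. (\<forall>k. C_k k u) \<and>
     compact (closure {x. u x \<noteq> 0}) \<and> closure {x. u x \<noteq> 0} \<subseteq> \<Omega>}"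

text \<open>Elements of \<open>L\<^sup>p\<close> are represented by functions, not by classes modulo null sets. The value
  \<open>Lp_norm M p f\<close> is meaningful only for \<open>f \<in> Lp_space M p\<close>.\<close>

definition Lp_space :: "'a measure \<Rightarrow> real \<Rightarrow> ('a \<Rightarrow> 'b::euclidean_space) set" where
  "Lp_space M p = {f. f \<in> borel_measurable M \<and> integrable M (\<lambda>x. norm (f x) powr p)}"

definition Lp_norm :: "'a measure \<Rightarrow> real \<Rightarrow> ('a \<Rightarrow> 'b::euclidean_space) \<Rightarrow> real" where
  "Lp_norm M p f = (LINT x|M. norm (f x) powr p) powr (1 / p)"

definition Lp_tendsto ::
    "'a measure \<Rightarrow> real \<Rightarrow> (nat \<Rightarrow> 'a \<Rightarrow> 'b::euclidean_space) \<Rightarrow> ('a \<Rightarrow> 'b) \<Rightarrow> bool" where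
  "Lp_tendsto M p f g \<longleftrightarrow> (\<forall>j. f j \<in> Lp_space M p) \<and> g \<in> Lp_space M p \<and>
     (\<lambda>j. Lp_norm M p (\<lambda>x. f j x - g x)) \<longlonglongrightarrow> 0"

definition Lp_Cauchy ::
    "'a measure \<Rightarrow> real \<Rightarrow> (nat \<Rightarrow> 'a \<Rightarrow> 'b::euclidean_space) \<Rightarrow> bool" where
  "Lp_Cauchy M p f \<longleftrightarrow> (\<forall>j. f j \<in> Lp_space M p) \<and>
     (\<forall>\<epsilon>>0. \<exists>N. \<forall>j\<ge>N. \<forall>k\<ge>N. Lp_norm M p (\<lambda>x. f j x - f k x) < \<epsilon>)"

definition frac_const :: "nat \<Rightarrow> real \<Rightarrow> real" where
  "frac_const n s = (real n + s - 1) *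
     (Gamma ((real n + s - 1) / 2) /
       (pi powr (real n / 2) * 2 powr (1 - s) * Gamma ((1 - s) / 2)))"

definition frac_grad_smooth :: "real \<Rightarrow> ('a::euclidean_space \<Rightarrow> real) \<Rightarrow> 'a \<Rightarrow> 'a" where
  "frac_grad_smooth s u x = frac_const DIM('a) s *\<^sub>R
     (LINT y|lborel. ((u x - u y) / norm (x - y) powr (real DIM('a) + s)) *\<^sub>R
        ((x - y) /\<^sub>R norm (x - y)))"

definition frac_sobolev :: "real \<Rightarrow> real \<Rightarrow> ('a::euclidean_space \<Rightarrow> real) set" where
  "frac_sobolev s p = {u \<in> Lp_space lebesgue p. \<exists>v.
     (\<forall>j. v j \<in> Cc_infinity UNIV) \<and> Lp_tendsto lebesgue p v u \<and>
     Lp_Cauchy lebesgue p (\<lambda>j. frac_grad_smooth s (v j))}"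

text \<open>The operator \<open>D\<^sup>s\<close> on \<open>H\<^sup>s\<^sup>,\<^sup>p\<close>. The limit is determined up to a null set (independently of
  the approximating sequence), and the choice operator picks one representative of it. On
  \<open>C\<^sub>c\<^sup>\<infinity>\<close> it therefore agrees almost everywhere with \<^const>\<open>frac_grad_smooth\<close>.\<close>

definition frac_grad :: "real \<Rightarrow> real \<Rightarrow> ('a::euclidean_space \<Rightarrow> real) \<Rightarrow> 'a \<Rightarrow> 'a" where
  "frac_grad s p u = (SOME g. \<exists>v. (\<forall>j. v j \<in> Cc_infinity UNIV) \<and>
     Lp_tendsto lebesgue p v u \<and>
     Lp_tendsto lebesgue p (\<lambda>j. frac_grad_smooth s (v j)) g)"

text \<open>The closure of \<open>C\<^sub>c\<^sup>\<infinity>(\<Omega>)\<close> in \<open>H\<^sup>s\<^sup>,\<^sup>p\<close>: by linearity of \<open>D\<^sup>s\<close>, convergence of \<open>v\<^sub>j\<close> to \<open>u\<close> in the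
  norm of \<open>H\<^sup>s\<^sup>,\<^sup>p\<close> is convergence in \<open>L\<^sup>p\<close> both of \<open>v\<^sub>j\<close> to \<open>u\<close> and of \<open>D\<^sup>s v\<^sub>j\<close> to \<open>D\<^sup>s u\<close>.\<close>

definition frac_sobolev0 ::
    "'a::euclidean_space set \<Rightarrow> real \<Rightarrow> real \<Rightarrow> ('a \<Rightarrow> real) set" where
  "frac_sobolev0 \<Omega> s p = {u \<in> frac_sobolev s p. \<exists>v.
     (\<forall>j. v j \<in> Cc_infinity \<Omega>) \<and> Lp_tendsto lebesgue p v u \<and>
     Lp_tendsto lebesgue p (\<lambda>j. frac_grad_smooth s (v j)) (frac_grad s p u)}"

end

theory Submission
  imports Defs "HOL-Probability.Distributions"
begin

text \<open>
  Let \<open>G\<^sub>t\<close> be the heat kernel and \<open>a = (1 - s) / 2\<close>. A Gamma integral writes the kernel of \<open>D\<^sup>s\<close> as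
  \<open>- \<integral> t\<^sup>a\<^sup>-\<^sup>1 \<nabla>G\<^sub>t dt / \<Gamma>(a)\<close>, so that \<open>D\<^sup>s u\<close> is an average over time of \<open>\<nabla>G\<^sub>t * u\<close>. By the semigroup
  property, \<open>\<nabla>G\<^sub>\<tau> * \<nabla>G\<^sub>t * u = \<partial>\<^sub>r (G\<^sub>r * u)\<close> at \<open>r = \<tau> + t\<close>. Convolving \<open>D\<^sup>s u\<close> with the truncated kernel
  \<open>- \<integral> \<tau>\<^sup>-\<^sup>a \<nabla>G\<^sub>\<tau> d\<tau>\<close> over \<open>0 < \<tau> < T\<close>, whose \<open>L\<^sup>1\<close> norm is at most \<open>(n + 1) T\<^sup>s\<^sup>/\<^sup>2 / s\<close>, and substituting
  \<open>t = \<tau> v\<close> therefore recovers \<open>u\<close> up to a mixture of the functions \<open>G\<^sub>r * u\<close> with \<open>r \<ge> T\<close>. These are bounded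
  by \<open>(4\<pi>T)\<^sup>-\<^sup>n\<^sup>/\<^sup>2\<close> times the \<open>L\<^sup>1\<close> norm of \<open>u\<close>, and for \<open>T\<close> large in terms of \<open>|\<Omega>|\<close> alone this error is absorbed
  into the left-hand side, uniformly in both \<open>s\<close> and \<open>p\<close>.
\<close>

section \<open>Lebesgue integrals\<close>

text \<open>Integrated over all \<tau>, the kernel would invert D^s exactly, but it is not
  integrable and gives no L^p bound by convolution; stopping at T buys integrability at the price of
  the error term, and boundedness of \<Omega> pays for that. The exponents -a and a - 1 are dual:
  the powers of \<tau> cancel, the integrand depends on \<tau> only through \<tau> (1 + v), and what
  remains is the Beta integral of v^(a-1) / (1 + v). It grows like 1 / a as s tends to 1 and so
  cancels the pole of Gamma at 0; the factor 1 / s comes from the mass of the truncated kernel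
  alone. No constant depends on p: convolution with an L^1 kernel is bounded on every L^p by the L^1
  norm, and the powers of |\<Omega>| from Hoelder and from a constant on \<Omega> multiply to
  |\<Omega>| itself. Sup and Lipschitz bounds of the test function justify the interchanges of
  integrals and the removal of a lower cutoff in time, and then drop out.\<close>

lemma distr_lborel_diff: "distr lborel borel (\<lambda>y. x - y) = (lborel :: 'a::euclidean_space measure)"
  using lborel_affine[of "-1" x] by (simp add: density_1)

lemma distr_lborel_add: "distr lborel borel (\<lambda>y. y + x) = (lborel :: 'a::euclidean_space measure)"
  using lborel_distr_plus[of x] by (simp add: add.commute[of _ x])

lemma nn_integral_lborel_diff:
  fixes x :: "'a::euclidean_space"
  assumes [measurable]: "f \<in> borel_measurable borel"
  shows "(\<integral>\<^sup>+y. f (x - y) \<partial>lborel) = (\<integral>\<^sup>+y. f y \<partial>lborel)"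
  by (subst distr_lborel_diff[of x, symmetric], subst nn_integral_distr) auto

lemma nn_integral_lborel_add:
  fixes x :: "'a::euclidean_space"
  assumes [measurable]: "f \<in> borel_measurable borel"
  shows "(\<integral>\<^sup>+y. f (y + x) \<partial>lborel) = (\<integral>\<^sup>+y. f y \<partial>lborel)"
  by (subst distr_lborel_add[of x, symmetric], subst nn_integral_distr) auto

lemma has_bochner_integral_lborel_diff:
  fixes x :: "'a::euclidean_space" and f :: "'a \<Rightarrow> 'b::{banach, second_countable_topology}"
  assumes f: "has_bochner_integral lborel f I"
  shows "has_bochner_integral lborel (\<lambda>y. f (x - y)) I"
proof -
  have [measurable]: "f \<in> borel_measurable borel"
    using f by (auto dest: borel_measurable_has_bochner_integral)
  have "has_bochner_integral (distr lborel borel (\<lambda>y. x - y)) f I"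
    using f by (simp add: distr_lborel_diff)
  then show ?thesis
    by (simp add: has_bochner_integral_iff integrable_distr_eq integral_distr)
qed

lemma has_bochner_integral_lborel_add:
  fixes x :: "'a::euclidean_space" and f :: "'a \<Rightarrow> 'b::{banach, second_countable_topology}"
  assumes f: "has_bochner_integral lborel f I"
  shows "has_bochner_integral lborel (\<lambda>y. f (y + x)) I"
proof -
  have [measurable]: "f \<in> borel_measurable borel"
    using f by (auto dest: borel_measurable_has_bochner_integral)
  have "has_bochner_integral (distr lborel borel (\<lambda>y. y + x)) f I"
    using f by (simp add: distr_lborel_add)
  then show ?thesis
    by (simp add: has_bochner_integral_iff integrable_distr_eq integral_distr)
qed

lemma lborel_integral_odd:
  fixes f :: "'a::euclidean_space \<Rightarrow> 'b::{banach, second_countable_topology}"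
  assumes f: "integrable lborel f" and odd: "\<And>x. f (- x) = - f x"
  shows "has_bochner_integral lborel f 0"
proof -
  have "has_bochner_integral lborel (\<lambda>y. f (0 - y)) (integral\<^sup>L lborel f)"
    by (rule has_bochner_integral_lborel_diff) (rule has_bochner_integral_integrable[OF f])
  then have "has_bochner_integral lborel (\<lambda>y. - f y) (integral\<^sup>L lborel f)"
    by (simp add: odd)
  then have "integral\<^sup>L lborel f = - integral\<^sup>L lborel f"
    by (auto dest: has_bochner_integral_integral_eq)
  then have "(1 + 1) *\<^sub>R integral\<^sup>L lborel f = 0"
    unfolding scaleR_left_distrib by (metis add.right_inverse scaleR_one)
  then show ?thesis
    using has_bochner_integral_integrable[OF f] by simp
qed

text \<open>Tonelli reduces integrability on the product to an integrable majorant, in the outer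
  variable, of the inner absolute integral. Every exchange of signed integrals below has this
  form.\<close>

lemma fubini_dominated:
  fixes f :: "'a::euclidean_space \<Rightarrow> 'b::euclidean_space \<Rightarrow> 'c::{banach, second_countable_topology}"
  assumes meas: "case_prod f \<in> borel_measurable (lborel \<Otimes>\<^sub>M lborel)"
    and m: "integrable lborel m" "\<And>x. (\<integral>\<^sup>+y. ennreal (norm (f x y)) \<partial>lborel) \<le> ennreal (m x)"
  shows "(LINT x|lborel. LINT y|lborel. f x y) = (LINT y|lborel. LINT x|lborel. f x y)"
proof -
  have "integrable (lborel \<Otimes>\<^sub>M lborel) (case_prod f)"
  proof (rule integrableI_bounded[OF meas])
    have "(\<integral>\<^sup>+p. ennreal (norm (case_prod f p)) \<partial>(lborel \<Otimes>\<^sub>M lborel)) =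
        (\<integral>\<^sup>+x. \<integral>\<^sup>+y. ennreal (norm (f x y)) \<partial>lborel \<partial>lborel)"
      using meas by (subst lborel.nn_integral_fst[symmetric]) auto
    also have "\<dots> \<le> (\<integral>\<^sup>+x. ennreal (m x) \<partial>lborel)"
      by (intro nn_integral_mono m(2))
    also have "\<dots> \<le> (\<integral>\<^sup>+x. ennreal (norm (m x)) \<partial>lborel)"
      by (intro nn_integral_mono ennreal_leI) simp
    also have "\<dots> < \<infinity>"
      using m(1) unfolding integrable_iff_bounded by blast
    finally show "(\<integral>\<^sup>+p. ennreal (norm (case_prod f p)) \<partial>(lborel \<Otimes>\<^sub>M lborel)) < \<infinity>" .
  qed
  then show ?thesis
    by (rule lborel_pair.Fubini_integral[symmetric])
qed

text \<open>A non-integrable function has Bochner integral 0 by convention, so norms can be pulled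
  inside iterated integrals without any integrability proof.\<close>

lemma integral_norm_le_nn_integral:
  fixes f :: "'b \<Rightarrow> 'c::{banach, second_countable_topology}"
  shows "ennreal (norm (integral\<^sup>L N f)) \<le> (\<integral>\<^sup>+x. ennreal (norm (f x)) \<partial>N)"
proof (cases "integrable N f")
  case True
  then show ?thesis by (rule integral_norm_bound_ennreal)
qed (simp add: not_integrable_integral_eq)

lemma powr_integral_from_0:
  fixes c T :: real
  assumes "0 < c" "0 \<le> T"
  shows "has_bochner_integral lborel (\<lambda>t. indicator {0..T} t * t powr (c - 1)) (T powr c / c)"
proof (rule has_bochner_integral_nn_integral)
  show "(\<integral>\<^sup>+t. ennreal (indicator {0..T} t * t powr (c - 1)) \<partial>lborel) = ennreal (T powr c / c)"
    using has_integral_powr_from_0[of "c - 1" T] assms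
    by (intro nn_integral_has_integral_lebesgue) auto
qed (use assms in auto)

lemma powr_integral_to_infinity:
  fixes c T :: real
  assumes "0 < c" "0 < T"
  shows "has_bochner_integral lborel (\<lambda>t. indicator {T..} t * t powr (- c - 1)) (T powr - c / c)"
proof (rule has_bochner_integral_nn_integral)
  show "(\<integral>\<^sup>+t. ennreal (indicator {T..} t * t powr (- c - 1)) \<partial>lborel) = ennreal (T powr - c / c)"
    using has_integral_powr_to_inf[where a = T and e = "- c - 1"] assms
    by (intro nn_integral_has_integral_lebesgue) auto
qed (use assms in auto)

section \<open>The heat kernel\<close>

definition heat :: "real \<Rightarrow> 'a::euclidean_space \<Rightarrow> real" where
  "heat t x = (4 * pi * t) powr (- real DIM('a) / 2) * exp (- (norm x)\<^sup>2 / (4 * t))"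

lemma heat_nonneg: "0 \<le> heat t x"
  by (simp add: heat_def)

lemma heat_minus [simp]: "heat t (- x) = heat t x"
  by (simp add: heat_def)

lemma heat_measurable [measurable (raw)]:
  assumes [measurable]: "f \<in> borel_measurable M" "g \<in> borel_measurable M"
  shows "(\<lambda>x. heat (f x) (g x :: 'a::euclidean_space)) \<in> borel_measurable M"
  unfolding heat_def by measurable

text \<open>With time scaled to the full Laplacian, the coordinates are independent centred
  Gaussians of variance 2 t; mass and second moment thus reduce to one-dimensional normal
  integrals.\<close>

lemma heat_eq_prod:
  fixes x :: "'a::euclidean_space"
  assumes "0 < t"
  shows "heat t x = (\<Prod>b\<in>Basis. normal_density 0 (sqrt (2 * t)) (x \<bullet> b))"
proof -
  have "(\<Prod>b\<in>Basis. normal_density 0 (sqrt (2 * t)) (x \<bullet> b)) =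
    (1 / sqrt (4 * pi * t)) ^ DIM('a) * exp (\<Sum>b\<in>Basis. - (x \<bullet> b)\<^sup>2 / (4 * t))"
    using assms by (simp add: normal_density_def prod.distrib exp_sum prod_dividef prod_constant power_divide mult_ac)
  also have "(\<Sum>b\<in>Basis. - (x \<bullet> b)\<^sup>2 / (4 * t)) = - (norm x)\<^sup>2 / (4 * t)"
    unfolding power2_norm_eq_inner euclidean_inner[of x x]
    by (simp add: sum_divide_distrib sum_negf power2_eq_square)
  also have "(1 / sqrt (4 * pi * t)) ^ DIM('a) = (4 * pi * t) powr (- real DIM('a) / 2)"
    using assms by (simp add: powr_half_sqrt[symmetric] powr_minus_divide[symmetric] powr_realpow[symmetric] powr_powr del: powr_half_sqrt)
  finally show ?thesis by (simp add: heat_def)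
qed

lemma heat_mass:
  assumes "0 < t"
  shows "has_bochner_integral lborel (heat t :: 'a::euclidean_space \<Rightarrow> real) 1"
proof (rule has_bochner_integral_nn_integral)
  have "(\<integral>\<^sup>+x. ennreal (heat t x) \<partial>(lborel::'a measure)) =
      (\<integral>\<^sup>+x. (\<Prod>b\<in>Basis. ennreal (normal_density 0 (sqrt (2 * t)) (x \<bullet> b))) \<partial>(lborel::'a measure))"
    using assms by (simp add: heat_eq_prod prod_ennreal)
  also have "\<dots> = (\<Prod>b\<in>(Basis::'a set). (\<integral>\<^sup>+x. ennreal (normal_density 0 (sqrt (2 * t)) x) \<partial>lborel))"
    by (rule nn_integral_lborel_prod) auto
  also have "(\<integral>\<^sup>+x. ennreal (normal_density 0 (sqrt (2 * t)) x) \<partial>lborel) = 1"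
    using assms by (subst nn_integral_eq_integral) auto
  finally show "(\<integral>\<^sup>+x. ennreal (heat t x) \<partial>(lborel::'a measure)) = ennreal 1" by simp
qed (auto simp: heat_nonneg)

lemma heat_second_moment:
  assumes t: "0 < t"
  shows "has_bochner_integral lborel (\<lambda>x::'a::euclidean_space. (norm x)\<^sup>2 * heat t x) (2 * real DIM('a) * t)"
proof -
  let ?g = "normal_density 0 (sqrt (2 * t))"
  have g0: "(\<integral>\<^sup>+x. ennreal (?g x) \<partial>lborel) = 1"
    using t by (subst nn_integral_eq_integral) auto
  have g2: "(\<integral>\<^sup>+x. ennreal (x\<^sup>2 * ?g x) \<partial>lborel) = ennreal (2 * t)"
    using normal_moment_even[of "sqrt (2 * t)" 0 1] t
    by (subst nn_integral_eq_integral)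
      (auto simp: has_bochner_integral_iff mult.commute fact_numeral eval_nat_numeral)
  have *: "has_bochner_integral lborel (\<lambda>x::'a. (x \<bullet> b)\<^sup>2 * heat t x) (2 * t)" if b: "b \<in> Basis" for b
  proof (rule has_bochner_integral_nn_integral)
    have eq: "(x \<bullet> b)\<^sup>2 * heat t x = (\<Prod>c\<in>Basis. (if c = b then (x \<bullet> c)\<^sup>2 else 1) * ?g (x \<bullet> c))" for x
      using t b by (simp add: heat_eq_prod prod.distrib prod.delta)
    have "(\<integral>\<^sup>+x. ennreal ((x \<bullet> b)\<^sup>2 * heat t x) \<partial>lborel) =
      (\<integral>\<^sup>+x. (\<Prod>c\<in>Basis. ennreal ((if c = b then (x \<bullet> c)\<^sup>2 else 1) * ?g (x \<bullet> c))) \<partial>(lborel::'a measure))"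
      unfolding eq by (subst prod_ennreal) auto
    also have "\<dots> = (\<Prod>c\<in>(Basis::'a set). \<integral>\<^sup>+x. ennreal ((if c = b then x\<^sup>2 else 1) * ?g x) \<partial>lborel)"
      by (rule nn_integral_lborel_prod) auto
    also have "\<dots> = (\<Prod>c\<in>(Basis::'a set). if c = b then ennreal (2 * t) else 1)"
      by (intro prod.cong refl) (auto simp: g0 g2)
    also have "\<dots> = ennreal (2 * t)"
      using b by (simp add: prod.delta)
    finally show "(\<integral>\<^sup>+x. ennreal ((x \<bullet> b)\<^sup>2 * heat t x) \<partial>lborel) = ennreal (2 * t)" .
  qed (use t in \<open>auto simp: heat_nonneg\<close>)
  have "has_bochner_integral lborel (\<lambda>x::'a. \<Sum>b\<in>Basis. (x \<bullet> b)\<^sup>2 * heat t x) (\<Sum>b\<in>(Basis::'a set). 2 * t)"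
    by (intro has_bochner_integral_sum *)
  moreover have "(\<Sum>b\<in>Basis. (x \<bullet> b)\<^sup>2 * heat t x) = (norm x)\<^sup>2 * heat t x" for x :: 'a
    unfolding power2_norm_eq_inner euclidean_inner[of x x]
    by (simp add: sum_distrib_right power2_eq_square)
  ultimately show ?thesis by (simp add: mult_ac)
qed

lemma heat_first_moment:
  assumes t: "0 < t"
  shows "integrable lborel (\<lambda>x::'a::euclidean_space. norm x * heat t x)"
    and "(LINT x|lborel. norm (x::'a) * heat t x) \<le> (real DIM('a) + 1) * sqrt t"
proof -
  let ?f = "\<lambda>x::'a. (norm x)\<^sup>2 * heat t x / (2 * sqrt t) + heat t x * (sqrt t / 2)"
  have "has_bochner_integral lborel ?f (2 * real DIM('a) * t / (2 * sqrt t) + 1 * (sqrt t / 2))"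
    using t by (intro has_bochner_integral_add has_bochner_integral_divide_zero
        has_bochner_integral_mult_left heat_second_moment heat_mass) auto
  also have "2 * real DIM('a) * t / (2 * sqrt t) + 1 * (sqrt t / 2) = (real DIM('a) + 1/2) * sqrt t"
  proof -
    have "2 * real DIM('a) * t / (2 * sqrt t) = real DIM('a) * (t / sqrt t)" by simp
    also have "t / sqrt t = sqrt t" using t by (simp add: real_div_sqrt)
    finally show ?thesis by (simp add: algebra_simps)
  qed
  finally have f: "has_bochner_integral lborel ?f ((real DIM('a) + 1/2) * sqrt t)" .
  have le: "norm x * heat t x \<le> ?f x" for x
  proof -
    \<comment> \<open>The weight sqrt t is the diffusive length at time t: it balances the two
      terms, and both contribute at the rate sqrt t.\<close>
    have "2 * norm x * sqrt t \<le> (norm x)\<^sup>2 + (sqrt t)\<^sup>2"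
      by (rule sum_squares_bound)
    then have "norm x \<le> (norm x)\<^sup>2 / (2 * sqrt t) + sqrt t / 2"
      using t by (simp add: field_simps power2_eq_square)
    from mult_right_mono[OF this heat_nonneg[of t x]] show ?thesis
      by (simp add: algebra_simps)
  qed
  show int: "integrable lborel (\<lambda>x::'a. norm x * heat t x)"
    by (rule Bochner_Integration.integrable_bound[of _ ?f])
      (use f le in \<open>auto simp: has_bochner_integral_iff heat_nonneg intro: order.trans[OF _ abs_ge_self]\<close>)
  have "(LINT x|lborel. norm (x::'a) * heat t x) \<le> integral\<^sup>L lborel ?f"
    using f int by (intro integral_mono le) (auto simp: has_bochner_integral_iff)
  also have "\<dots> = (real DIM('a) + 1/2) * sqrt t"
    using f by (rule has_bochner_integral_integral_eq)
  also have "\<dots> \<le> (real DIM('a) + 1) * sqrt t"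
    using t by (intro mult_right_mono) auto
  finally show "(LINT x|lborel. norm (x::'a) * heat t x) \<le> (real DIM('a) + 1) * sqrt t" .
qed

lemma heat_le:
  assumes "0 < t"
  shows "heat t (x::'a::euclidean_space) \<le> (4 * pi * t) powr (- real DIM('a) / 2)"
  using assms by (simp add: heat_def mult_left_le)

section \<open>Gradient and time derivative of the heat kernel\<close>

text \<open>The negative of the spatial gradient of \<open>heat t\<close>; with this sign it points
  along x, as the kernel of D^s does.\<close>

definition hgrad :: "real \<Rightarrow> 'a::euclidean_space \<Rightarrow> 'a" where
  "hgrad t x = (heat t x / (2 * t)) *\<^sub>R x"

text \<open>The time derivative of \<open>heat\<close> (see \<open>heat_has_derivative\<close>) and,
  by the heat equation, also its Laplacian; the second reading explains why a convolution of two
  gradients produces it.\<close>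

definition dheat :: "real \<Rightarrow> 'a::euclidean_space \<Rightarrow> real" where
  "dheat t x = ((norm x)\<^sup>2 / (4 * t\<^sup>2) - real DIM('a) / (2 * t)) * heat t x"

lemma hgrad_measurable [measurable (raw)]:
  assumes [measurable]: "f \<in> borel_measurable M" "g \<in> borel_measurable M"
  shows "(\<lambda>x. hgrad (f x) (g x :: 'a::euclidean_space)) \<in> borel_measurable M"
  unfolding hgrad_def by measurable

lemma dheat_measurable [measurable (raw)]:
  assumes [measurable]: "f \<in> borel_measurable M" "g \<in> borel_measurable M"
  shows "(\<lambda>x. dheat (f x) (g x :: 'a::euclidean_space)) \<in> borel_measurable M"
  unfolding dheat_def by measurable

lemma norm_hgrad: "0 < t \<Longrightarrow> norm (hgrad t x) = norm x * heat t x / (2 * t)"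
  by (simp add: hgrad_def heat_nonneg)

lemma hgrad_minus: "hgrad t (- x) = - hgrad t x"
  by (simp add: hgrad_def)

text \<open>The first moment divided by 2 t gives the rate 1 / sqrt t. Its decay makes the time
  average for D^s converge at infinity; its singularity at 0 is integrable against t^(-a).\<close>

lemma nn_integral_norm_hgrad:
  assumes t: "0 < t"
  shows "(\<integral>\<^sup>+x. ennreal (norm (hgrad t (x::'a::euclidean_space))) \<partial>lborel)
    \<le> ennreal ((real DIM('a) + 1) / (2 * sqrt t))"
proof -
  have "(\<integral>\<^sup>+x. ennreal (norm (hgrad t (x::'a))) \<partial>lborel) =
      ennreal (LINT x|lborel. norm (x::'a) * heat t x / (2 * t))"
    using t heat_first_moment[OF t, where 'a='a]
    by (subst nn_integral_eq_integral[symmetric]) (auto simp: norm_hgrad heat_nonneg)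
  also have "\<dots> \<le> ennreal ((real DIM('a) + 1) * sqrt t / (2 * t))"
    using t heat_first_moment[OF t, where 'a='a]
    by (intro ennreal_leI) (simp add: divide_right_mono)
  also have "(real DIM('a) + 1) * sqrt t / (2 * t) = (real DIM('a) + 1) / (2 * sqrt t)"
  proof -
    have "sqrt t / t = 1 / sqrt t" using t by (metis inverse_eq_divide less_imp_le sqrt_divide_self_eq)
    then have "c * sqrt t / (2 * t) = c / (2 * sqrt t)" for c
      using t by (simp add: divide_simps)
    then show ?thesis .
  qed
  finally show ?thesis .
qed

lemma integrable_hgrad: "0 < t \<Longrightarrow> integrable lborel (hgrad t :: 'a::euclidean_space \<Rightarrow> 'a)"
  using nn_integral_norm_hgrad[of t, where 'a='a]
  by (intro integrableI_bounded) (auto intro: le_less_trans)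

lemma hgrad_integral_0: "0 < t \<Longrightarrow> has_bochner_integral lborel (hgrad t :: 'a::euclidean_space \<Rightarrow> 'a) 0"
  by (intro lborel_integral_odd integrable_hgrad hgrad_minus)

text \<open>The extra factor |x| absorbs the singularity: the integrand is |x|^2 G_t / (2 t), a
  second moment at the scale of t. For a Lipschitz function this keeps \<open>flow\<close> bounded
  as t tends to 0.\<close>

lemma nn_integral_norm_times_hgrad:
  assumes t: "0 < t"
  shows "(\<integral>\<^sup>+x. ennreal (norm x * norm (hgrad t (x::'a::euclidean_space))) \<partial>lborel) = ennreal (real DIM('a))"
proof -
  have "has_bochner_integral lborel (\<lambda>x::'a. (norm x)\<^sup>2 * heat t x / (2 * t)) (2 * real DIM('a) * t / (2 * t))"
    using t by (intro has_bochner_integral_divide_zero heat_second_moment)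
  then have "has_bochner_integral lborel (\<lambda>x::'a. norm x * norm (hgrad t x)) (real DIM('a))"
    using t by (simp add: norm_hgrad power2_eq_square mult.assoc)
  then show ?thesis
    by (subst nn_integral_eq_integral) (auto simp: has_bochner_integral_iff)
qed

lemma nn_integral_dheat:
  assumes t: "0 < t"
  shows "(\<integral>\<^sup>+x. ennreal (norm (dheat t (x::'a::euclidean_space))) \<partial>lborel) \<le> ennreal (real DIM('a) / t)"
proof -
  let ?f = "\<lambda>x::'a. (norm x)\<^sup>2 * heat t x / (4 * t\<^sup>2) + heat t x * (real DIM('a) / (2 * t))"
  have "has_bochner_integral lborel ?f (2 * real DIM('a) * t / (4 * t\<^sup>2) + 1 * (real DIM('a) / (2 * t)))"
    using t by (intro has_bochner_integral_add has_bochner_integral_divide_zero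
        has_bochner_integral_mult_left heat_second_moment heat_mass) auto
  also have "2 * real DIM('a) * t / (4 * t\<^sup>2) + 1 * (real DIM('a) / (2 * t)) = real DIM('a) / t"
    using t by (simp add: field_simps power2_eq_square)
  finally have f: "(\<integral>\<^sup>+x. ennreal (?f x) \<partial>lborel) = ennreal (real DIM('a) / t)"
    using t by (subst nn_integral_eq_integral) (auto simp: has_bochner_integral_iff heat_nonneg)
  have "norm (dheat t x) \<le> ?f x" for x
  proof -
    have "\<bar>(norm x)\<^sup>2 / (4 * t\<^sup>2) - real DIM('a) / (2 * t)\<bar> \<le> (norm x)\<^sup>2 / (4 * t\<^sup>2) + real DIM('a) / (2 * t)"
      using t by (intro abs_leI) auto
    from mult_right_mono[OF this heat_nonneg[of t x]]
    have "norm (dheat t x) \<le> ((norm x)\<^sup>2 / (4 * t\<^sup>2) + real DIM('a) / (2 * t)) * heat t x"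
      by (simp only: dheat_def real_norm_def abs_mult abs_of_nonneg[OF heat_nonneg])
    then show ?thesis
      by (simp add: algebra_simps)
  qed
  then show ?thesis
    unfolding f[symmetric] by (intro nn_integral_mono ennreal_leI)
qed

section \<open>The semigroup property for gradients\<close>

text \<open>Completing the square in y: for fixed v the product of two Gaussians is again one,
  centred at t v / (\<tau> + t). Integration over y would give the semigroup law; the pointwise form
  also handles polynomial factors.\<close>

lemma heat_mult_heat:
  fixes v y :: "'a::euclidean_space"
  assumes "0 < \<tau>" "0 < t"
  shows "heat \<tau> (v - y) * heat t y =
    heat (\<tau> + t) v * heat (\<tau> * t / (\<tau> + t)) (y - (t / (\<tau> + t)) *\<^sub>R v)"
proof -
  let ?r = "\<tau> + t" and ?\<rho> = "\<tau> * t / (\<tau> + t)"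
  have "(4 * pi * \<tau>) * (4 * pi * t) = (4 * pi * ?r) * (4 * pi * ?\<rho>)"
    using assms by (simp add: field_simps)
  then have 1: "(4 * pi * \<tau>) powr k * (4 * pi * t) powr k = (4 * pi * ?r) powr k * (4 * pi * ?\<rho>) powr k" for k
    using powr_mult[of "4 * pi * \<tau>" "4 * pi * t" k] powr_mult[of "4 * pi * ?r" "4 * pi * ?\<rho>" k] assms
    by (simp only:)
  have alg: "(A - 2 * B + C) / (4 * \<tau>) + C / (4 * t) =
      A / (4 * ?r) + (C - 2 * (t / ?r) * B + (t / ?r)\<^sup>2 * A) / (4 * ?\<rho>)" for A B C :: real
    using assms by (simp add: divide_simps) (simp add: algebra_simps power2_eq_square)
  have 2: "(norm (v - y))\<^sup>2 / (4 * \<tau>) + (norm y)\<^sup>2 / (4 * t) =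
     (norm v)\<^sup>2 / (4 * ?r) + (norm (y - (t / ?r) *\<^sub>R v))\<^sup>2 / (4 * ?\<rho>)"
    using alg[of "v \<bullet> v" "v \<bullet> y" "y \<bullet> y"]
    unfolding power2_norm_eq_inner
    by (simp add: inner_diff_left inner_diff_right inner_commute[of y v] power2_eq_square algebra_simps)
  have "heat \<tau> (v - y) * heat t y = ((4 * pi * \<tau>) powr (- real DIM('a) / 2) * (4 * pi * t) powr (- real DIM('a) / 2))
     * exp (- ((norm (v - y))\<^sup>2 / (4 * \<tau>) + (norm y)\<^sup>2 / (4 * t)))"
    by (simp add: heat_def exp_add[symmetric] del: exp_add)
  also have "\<dots> = heat ?r v * heat ?\<rho> (y - (t / ?r) *\<^sub>R v)"
    unfolding 1 2 by (simp add: heat_def exp_add[symmetric] del: exp_add)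
  finally show ?thesis .
qed

text \<open>By \<open>heat_mult_heat\<close> the integrand is a quadratic polynomial times a single
  Gaussian, so mass, oddness and second moment decide the integral. The two minus signs of
  \<open>hgrad\<close> cancel, which leaves the Laplacian of G at time \<tau> + t.\<close>

lemma hgrad_convolution_0:
  fixes v :: "'a::euclidean_space"
  assumes pos: "0 < \<tau>" "0 < t"
  shows "has_bochner_integral lborel (\<lambda>y. hgrad \<tau> (v - y) \<bullet> hgrad t y) (dheat (\<tau> + t) v)"
proof -
  define r where "r = \<tau> + t"
  define \<rho> where "\<rho> = \<tau> * t / r"
  have r: "0 < r" and \<rho>: "0 < \<rho>" using pos by (auto simp: r_def \<rho>_def)
  let ?c = "heat r v / (4 * \<tau> * t)"
  \<comment> \<open>The integrand in the centred variable w = y - (t / r) v. Its linear term is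
    written with \<open>hgrad \<rho>\<close>, whose integral is already known to vanish.\<close>
  let ?P = "\<lambda>w. ?c * (heat \<rho> w * ((\<tau> * t / r\<^sup>2) * (norm v)\<^sup>2)
       + ((2 * \<rho>) * ((\<tau> - t) / r)) * (v \<bullet> hgrad \<rho> w) - (norm w)\<^sup>2 * heat \<rho> w)"
  have "has_bochner_integral lborel ?P
     (?c * (1 * ((\<tau> * t / r\<^sup>2) * (norm v)\<^sup>2) + ((2 * \<rho>) * ((\<tau> - t) / r)) * (v \<bullet> 0) - 2 * real DIM('a) * \<rho>))"
    by (intro has_bochner_integral_mult_right has_bochner_integral_diff has_bochner_integral_add
       has_bochner_integral_mult_left heat_mass heat_second_moment has_bochner_integral_inner_right hgrad_integral_0 \<rho>)
  also have "?c * (1 * ((\<tau> * t / r\<^sup>2) * (norm v)\<^sup>2) + ((2 * \<rho>) * ((\<tau> - t) / r)) * (v \<bullet> 0) - 2 * real DIM('a) * \<rho>)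
      = dheat r v"
    using pos r unfolding dheat_def \<rho>_def by (simp add: field_simps power2_eq_square)
  finally have "has_bochner_integral lborel (\<lambda>y. ?P (y + (- ((t / r) *\<^sub>R v)))) (dheat r v)"
    by (rule has_bochner_integral_lborel_add)
  moreover have "?P (y + (- ((t / r) *\<^sub>R v))) = hgrad \<tau> (v - y) \<bullet> hgrad t y" for y
  proof -
    define w where "w = y - (t / r) *\<^sub>R v"
    have y: "y = w + (t / r) *\<^sub>R v" by (simp add: w_def)
    have vy: "v - y = (\<tau> / r) *\<^sub>R v - w"
    proof -
      have "v = ((\<tau> + t) / r) *\<^sub>R v" using r by (simp add: r_def)
      then have "v = (\<tau> / r) *\<^sub>R v + (t / r) *\<^sub>R v" by (metis add_divide_distrib scaleR_left_distrib)
      then show ?thesis by (simp add: y algebra_simps)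
    qed
    have "hgrad \<tau> (v - y) \<bullet> hgrad t y = (heat \<tau> (v - y) * heat t y) / (4 * \<tau> * t) * ((v - y) \<bullet> y)"
      by (simp add: hgrad_def mult_ac)
    also have "\<dots> = ?c * heat \<rho> w * ((v - y) \<bullet> y)"
      using heat_mult_heat[OF pos, of v y] by (simp add: r_def[symmetric] \<rho>_def[symmetric] w_def[symmetric])
    also have "(v - y) \<bullet> y = (\<tau> * t / r\<^sup>2) * (norm v)\<^sup>2 + ((\<tau> - t) / r) * (v \<bullet> w) - (norm w)\<^sup>2"
      unfolding vy unfolding y power2_norm_eq_inner using r
      by (simp add: inner_diff_left inner_add_right inner_commute[of w v] field_simps power2_eq_square)
    finally have eq: "hgrad \<tau> (v - y) \<bullet> hgrad t y =
      ?c * heat \<rho> w * ((\<tau> * t / r\<^sup>2) * (norm v)\<^sup>2 + ((\<tau> - t) / r) * (v \<bullet> w) - (norm w)\<^sup>2)" .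
    have "2 * \<rho> * k * (v \<bullet> hgrad \<rho> w) = k * (heat \<rho> w * (v \<bullet> w))" for k
      using \<rho> by (simp add: hgrad_def)
    from this[of "(\<tau> - t) / r"] have "?P w = ?c * heat \<rho> w * ((\<tau> * t / r\<^sup>2) * (norm v)\<^sup>2 + ((\<tau> - t) / r) * (v \<bullet> w) - (norm w)\<^sup>2)"
      by (simp only: right_diff_distrib distrib_left mult.assoc) (simp only: mult_ac)
    then show ?thesis
      by (simp add: eq w_def)
  qed
  ultimately show ?thesis by (simp add: r_def)
qed

lemma hgrad_convolution:
  fixes x z :: "'a::euclidean_space"
  assumes "0 < \<tau>" "0 < t"
  shows "has_bochner_integral lborel (\<lambda>y. hgrad \<tau> (x - y) \<bullet> hgrad t (y - z)) (dheat (\<tau> + t) (x - z))"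
  using has_bochner_integral_lborel_add[OF hgrad_convolution_0[OF assms, of "x - z"], of "- z"]
  by simp

lemma heat_has_derivative:
  assumes t: "0 < t"
  shows "((\<lambda>t. heat t (x::'a::euclidean_space)) has_real_derivative dheat t x) (at t)"
proof -
  let ?k = "- real DIM('a) / 2"
  have 1: "((\<lambda>t. (4 * pi * t) powr k) has_real_derivative k / t * (4 * pi * t) powr k) (at t)" for k
  proof -
    have "((\<lambda>t. (4 * pi * t) powr k) has_real_derivative (k * (4 * pi * t) powr (k - 1)) * (4 * pi)) (at t)"
      using t by (intro DERIV_chain2[OF has_real_derivative_powr] DERIV_cmult_Id) auto
    also have "(4 * pi * t) powr (k - 1) = (4 * pi * t) powr k / (4 * pi * t)"
      using t by (simp add: powr_diff)
    finally show ?thesis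
      using t by (simp add: field_simps)
  qed
  have 2: "((\<lambda>t. exp (- (norm x)\<^sup>2 / (4 * t))) has_real_derivative
      (norm x)\<^sup>2 / (4 * t\<^sup>2) * exp (- (norm x)\<^sup>2 / (4 * t))) (at t)"
    using t by (auto intro!: derivative_eq_intros simp: divide_simps power2_eq_square)
  have "((\<lambda>t. heat t x) has_real_derivative
    ?k / t * (4 * pi * t) powr ?k * exp (- (norm x)\<^sup>2 / (4 * t))
     + (norm x)\<^sup>2 / (4 * t\<^sup>2) * exp (- (norm x)\<^sup>2 / (4 * t)) * (4 * pi * t) powr ?k) (at t)"
    unfolding heat_def by (rule DERIV_mult[OF 1 2])
  also have "?k / t * (4 * pi * t) powr ?k * exp (- (norm x)\<^sup>2 / (4 * t))
     + (norm x)\<^sup>2 / (4 * t\<^sup>2) * exp (- (norm x)\<^sup>2 / (4 * t)) * (4 * pi * t) powr ?k = dheat t x"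
    using t by (simp add: dheat_def heat_def field_simps power2_eq_square)
  finally show ?thesis .
qed

text \<open>The fundamental theorem of calculus, away from the singular time 0. In the application c
  is 1 + v, and the division by c produces the Beta integrand.\<close>

lemma dheat_integral:
  fixes x :: "'a::euclidean_space"
  assumes "0 < \<epsilon>" "\<epsilon> \<le> T" "0 < c"
  shows "(LINT \<tau>|lborel. dheat (\<tau> * c) x * indicator {\<epsilon>..T} \<tau>) = (heat (T * c) x - heat (\<epsilon> * c) x) / c"
proof -
  have "(LINT \<tau>|lborel. dheat (\<tau> * c) x * indicator {\<epsilon>..T} \<tau>) = heat (T * c) x / c - heat (\<epsilon> * c) x / c"
  proof (rule integral_FTC_Icc_real[where F = "\<lambda>\<tau>. heat (\<tau> * c) x / c"])
    fix \<tau> assume "\<epsilon> \<le> \<tau>" "\<tau> \<le> T"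
    then have p: "0 < \<tau> * c" using assms by simp
    have "((\<lambda>\<tau>. heat (\<tau> * c) x) has_real_derivative dheat (\<tau> * c) x * c) (at \<tau>)"
      by (rule DERIV_chain'[where f = "\<lambda>\<tau>. \<tau> * c" and E = "dheat (\<tau> * c) x"])
        (auto intro!: derivative_eq_intros heat_has_derivative[OF p])
    from DERIV_cdivide[OF this, of c] show "((\<lambda>\<tau>. heat (\<tau> * c) x / c) has_real_derivative dheat (\<tau> * c) x) (at \<tau>)"
      using assms by simp
    show "isCont (\<lambda>\<tau>. dheat (\<tau> * c) x) \<tau>"
      unfolding dheat_def heat_def using p by (intro continuous_intros) auto
  qed (use assms in auto)
  then show ?thesis by (simp add: diff_divide_distrib)
qed

section \<open>Subordination: the kernel of D^s as a Gamma integral\<close>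

text \<open>The substitution v = q / t in Euler's integral for \<open>Gamma \<beta>\<close>; it
  reverses the half-line, which is why the Jacobian appears in absolute value.\<close>

lemma inverse_gamma_integral:
  fixes q \<beta> :: real
  assumes q: "0 < q" and \<beta>: "0 < \<beta>"
  shows "has_bochner_integral lborel (\<lambda>t::real. indicator {0<..} t * (t powr (- \<beta> - 1) * exp (- q / t)))
     (Gamma \<beta> * q powr - \<beta>)"
proof -
  let ?f = "\<lambda>v::real. v powr (\<beta> - 1) / exp v"
  let ?h = "\<lambda>t::real. \<bar>- q / t\<^sup>2\<bar> * ?f (q / t)"
  have im: "(\<lambda>t. q / t) ` {0<..} = {0::real<..}"
  proof (intro equalityI subsetI)
    fix v :: real assume v: "v \<in> {0<..}"
    then have "v = q / (q / v)" "q / v \<in> {0<..}" using q by auto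
    then show "v \<in> (\<lambda>t. q / t) ` {0<..}" by (rule image_eqI)
  qed (use q in auto)
  have f0: "(?f has_integral Gamma \<beta>) {0<..}"
  proof -
    have "(?f has_integral Gamma \<beta>) {0..} \<longleftrightarrow> (?f has_integral Gamma \<beta>) {0<..}"
      by (rule has_integral_spike_set_eq) (auto intro: negligible_subset[of "{0}"])
    then show ?thesis using Gamma_integral_real[OF \<beta>] by simp
  qed
  then have f: "?f absolutely_integrable_on {0<..} \<and> integral {0<..} ?f = Gamma \<beta>"
    by (auto intro!: nonnegative_absolutely_integrable_1 simp: has_integral_iff)
  have "?h absolutely_integrable_on {0<..} \<and> integral {0<..} ?h = Gamma \<beta> \<longleftrightarrow>
    ?f absolutely_integrable_on ((\<lambda>t. q / t) ` {0<..}) \<and> integral ((\<lambda>t. q / t) ` {0<..}) ?f = Gamma \<beta>"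
  proof (rule has_absolute_integral_change_of_variables_1')
    show "((\<lambda>t. q / t) has_field_derivative - q / t\<^sup>2) (at t within {0<..})" if "t \<in> {0<..}" for t
      using that by (auto intro!: derivative_eq_intros simp: power2_eq_square)
    show "inj_on (\<lambda>t. q / t) {0<..}" using q by (auto intro!: inj_onI)
  qed auto
  then have "?h absolutely_integrable_on {0<..} \<and> integral {0<..} ?h = Gamma \<beta>"
    using f unfolding im by blast
  then have "has_bochner_integral lebesgue (\<lambda>t. indicator {0<..} t *\<^sub>R ?h t) (Gamma \<beta>)"
    using set_lebesgue_integral_eq_integral(2)[of "{0<..}" ?h]
    by (simp add: has_bochner_integral_iff set_integrable_def set_lebesgue_integral_def)
  then have "has_bochner_integral lborel (\<lambda>t. indicator {0<..} t *\<^sub>R ?h t) (Gamma \<beta>)"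
    by (simp add: has_bochner_integral_iff integrable_completion integral_completion)
  from has_bochner_integral_mult_left[OF this, of "q powr - \<beta>"]
  have "has_bochner_integral lborel (\<lambda>t. indicator {0<..} t *\<^sub>R ?h t * q powr - \<beta>) (Gamma \<beta> * q powr - \<beta>)"
    by simp
  moreover have "indicator {0<..} t *\<^sub>R ?h t * q powr - \<beta> = indicator {0<..} t * (t powr (- \<beta> - 1) * exp (- q / t))" for t :: real
  proof (cases "0 < t")
    case True
    then have "?h t * q powr - \<beta> = (q powr 1 * q powr (\<beta> - 1) * q powr - \<beta>) * (t powr - 2 * t powr (1 - \<beta>)) * exp (- (q / t))"
    proof -
      have "q * q powr (\<beta> - 1) * q powr - \<beta> = 1"
        using q by (simp add: powr_mult_base powr_add[symmetric])
      moreover have "t powr (1 - \<beta>) * t powr (\<beta> - 1) = 1" "t powr - 2 * t\<^sup>2 = 1"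
        using True by (simp_all add: powr_add[symmetric] powr_minus_divide)
      then have "t powr (1 - \<beta>) * t powr (\<beta> - 1) * (t powr - 2 * t\<^sup>2) = 1" by simp
      then have "t\<^sup>2 * (t powr (1 - \<beta>) * (t powr (\<beta> - 1) * t powr - 2)) = 1"
        by (simp only: mult_ac)
      ultimately show ?thesis
        using True q by (simp add: powr_divide exp_minus field_simps)
    qed
    also have "\<dots> = t powr (- \<beta> - 1) * exp (- q / t)"
    proof -
      have e: "- 2 + (1 - \<beta>) = - \<beta> - 1" by simp
      have "t powr - 2 * t powr (1 - \<beta>) = t powr (- \<beta> - 1)"
        unfolding powr_add[symmetric] e ..
      then show ?thesis using q by (simp add: powr_add[symmetric] powr_mult_base)
    qed
    finally show ?thesis using True by simp
  qed auto
  ultimately show ?thesis by simp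
qed

text \<open>The Gaussian exponent is q / t with q = |w|^2 / 4, and collecting the powers of t gives
  \<beta> = n / 2 + 1 - a = (n + s + 1) / 2. The constant is then that of D^s: the factor n + s - 1
  in \<open>frac_const\<close> comes from shifting the argument of Gamma from (n + s + 1) / 2 to (n
  + s - 1) / 2, and its denominator contains \<open>Gamma a\<close>.\<close>

lemma hgrad_subordination:
  fixes w :: "'a::euclidean_space"
  assumes s: "0 < s" "s < 1" and w: "w \<noteq> 0"
  defines "a \<equiv> (1 - s) / 2"
  shows "has_bochner_integral lborel (\<lambda>t. (indicator {0<..} t * t powr (a - 1)) *\<^sub>R hgrad t w)
    ((Gamma a * frac_const DIM('a) s / norm w powr (real DIM('a) + s)) *\<^sub>R (w /\<^sub>R norm w))"
proof -
  define n where "n = real DIM('a)"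
  define \<beta> where "\<beta> = (n + s + 1) / 2"
  define q where "q = (norm w)\<^sup>2 / 4"
  have n: "1 \<le> n" by (simp add: n_def DIM_positive Suc_leI)
  have a: "0 < a" "a < 1/2" using s by (auto simp: a_def)
  have \<beta>: "0 < \<beta>" "\<beta> = n / 2 + 1 - a" using s n by (auto simp: \<beta>_def a_def field_simps)
  have q: "0 < q" using w by (simp add: q_def)
  let ?c = "(4 * pi) powr (- n / 2) / 2"
  have "has_bochner_integral lborel
     (\<lambda>t. (?c * (indicator {0<..} t * (t powr (- \<beta> - 1) * exp (- q / t)))) *\<^sub>R w)
     ((?c * (Gamma \<beta> * q powr - \<beta>)) *\<^sub>R w)"
    by (intro has_bochner_integral_scaleR_left has_bochner_integral_mult_right inverse_gamma_integral q \<beta>)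
  moreover have "(indicator {0<..} t * t powr (a - 1)) *\<^sub>R hgrad t w =
      (?c * (indicator {0<..} t * (t powr (- \<beta> - 1) * exp (- q / t)))) *\<^sub>R w" for t
  proof (cases "0 < t")
    case True
    have "t powr (a - 1) * (heat t w / (2 * t)) =
       ?c * ((t powr (a - 1) * t powr (- n / 2) * t powr - 1) * exp (- q / t))"
      using True by (simp add: heat_def powr_mult q_def n_def[symmetric] powr_minus field_simps)
    also have "t powr (a - 1) * t powr (- n / 2) * t powr - 1 = t powr (- \<beta> - 1)"
      unfolding powr_add[symmetric] by (rule arg_cong2[where f = "(powr)"]) (auto simp: \<beta>)
    finally show ?thesis using True by (simp add: hgrad_def)
  qed auto
  moreover have "(?c * (Gamma \<beta> * q powr - \<beta>)) *\<^sub>R w =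
      (Gamma a * frac_const DIM('a) s / norm w powr (n + s)) *\<^sub>R (w /\<^sub>R norm w)"
  proof -
    have G: "Gamma \<beta> = (n + s - 1) / 2 * Gamma ((n + s - 1) / 2)"
    proof -
      have "\<beta> = (n + s - 1) / 2 + 1" by (simp add: \<beta>_def field_simps)
      moreover have "(n + s - 1) / 2 \<notin> \<int>\<^sub>\<le>\<^sub>0" using n s by (auto elim!: nonpos_Ints_cases)
      ultimately show ?thesis by (simp add: Gamma_plus1)
    qed
    have Ga: "Gamma a \<noteq> 0" using Gamma_real_pos[OF a(1)] by simp
    have c: "Gamma a * frac_const DIM('a) s = Gamma \<beta> * (pi powr (- n / 2) * 2 powr s)"
    proof -
      have e1: "2 powr (1 - s) = 2 / 2 powr s" by (simp add: powr_diff)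
      have e2: "pi powr (- n / 2) = 1 / pi powr (n / 2)" by (simp add: powr_minus_divide)
      show ?thesis using Ga unfolding frac_const_def G n_def[symmetric] a_def[symmetric] e1 e2
        by (simp add: field_simps)
    qed
    have "q powr - \<beta> = 4 powr \<beta> / (norm w powr 2) powr \<beta>"
      using w unfolding q_def by (simp add: powr_minus_divide powr_divide)
    also have "(norm w powr 2) powr \<beta> = norm w powr (n + s) * norm w"
    proof -
      have "2 * \<beta> = (n + s) + 1" by (simp add: \<beta>_def)
      then show ?thesis by (simp only: powr_powr) (simp add: powr_add)
    qed
    finally have qb: "q powr - \<beta> = 4 powr \<beta> / (norm w powr (n + s) * norm w)" .
    have "?c * 4 powr \<beta> = pi powr (- n / 2) * ((2 powr 2) powr (- n / 2) * (2 powr 2) powr \<beta> * 2 powr - 1)"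
      by (simp add: powr_mult powr_minus_divide)
    also have "(2 powr 2) powr (- n / 2) * (2 powr 2) powr \<beta> * 2 powr - 1 = 2 powr (s::real)"
    proof -
      have "2 * (- n / 2) + 2 * \<beta> + - 1 = s" by (simp add: \<beta>_def field_simps)
      then show ?thesis by (simp only: powr_powr powr_add[symmetric])
    qed
    finally have k: "?c * 4 powr \<beta> = pi powr (- n / 2) * 2 powr s" .
    have "?c * (Gamma \<beta> * q powr - \<beta>) = Gamma \<beta> * (?c * 4 powr \<beta>) / (norm w powr (n + s) * norm w)"
      unfolding qb by simp
    also have "\<dots> = Gamma a * frac_const DIM('a) s / norm w powr (n + s) * inverse (norm w)"
      unfolding c k by (simp add: divide_simps)
    finally show ?thesis by simp
  qed
  ultimately show ?thesis by (simp only: n_def)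
qed

section \<open>The fractional gradient as an average over time\<close>

text \<open>What the argument uses of a test function, in a form free of derivatives.
  \<open>M\<close> and \<open>L\<close> serve convergence and limits; neither occurs in
  \<open>pointwise_estimate\<close>.\<close>

locale heat_test_function =
  fixes u :: "'a::euclidean_space \<Rightarrow> real" and M L s :: real
  assumes borel_u [measurable]: "u \<in> borel_measurable borel"
    and bound: "\<And>x. \<bar>u x\<bar> \<le> M"
    and L0: "0 \<le> L"
    and lipschitz: "\<And>x y. \<bar>u x - u y\<bar> \<le> L * norm (x - y)"
    and int_u: "integrable lborel u"
    and s: "0 < s" "s < 1"
begin

definition a :: real where "a = (1 - s) / 2"
definition n :: real where "n = real DIM('a)"
text \<open>For t > 0 this is the gradient of G_t * u, cf. \<open>flow_eq\<close>. The difference u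
  y - u z is kept because without it the bound at small times is of order 1 / sqrt t, which is not
  integrable against t^(a-1).\<close>

definition flow :: "real \<Rightarrow> 'a \<Rightarrow> 'a" where
  "flow t y = (LINT z|lborel. (u y - u z) *\<^sub>R hgrad t (y - z))"
text \<open>A majorant of the time average of \<open>flow\<close>, uniform in space. The Lipschitz
  branch, of order t^(a-1), serves small times and is integrable as a > 0; the sup branch, of order
  t^(a-3/2), serves large times and is integrable as a < 1/2.\<close>

definition envelope :: "real \<Rightarrow> real" where
  "envelope t = indicator {0<..} t * t powr (a - 1) * min (L * n) (M * (n + 1) / sqrt t)"

lemma a: "0 < a" "a < 1/2" using s by (auto simp: a_def)

lemma M0: "0 \<le> M" using bound[of 0] by linarith

lemma n: "1 \<le> n" by (simp add: n_def DIM_positive Suc_leI)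

lemma envelope_nonneg: "0 \<le> envelope t"
  unfolding envelope_def using L0 M0 n by (cases "0 < t") auto

lemma integrable_envelope: "integrable lborel envelope"
proof (rule Bochner_Integration.integrable_bound)
  let ?g = "\<lambda>t. indicator {0..1} t * t powr (a - 1) * (L * n) +
     indicator {1..} t * t powr (- (1/2 - a) - 1) * (M * (n + 1))"
  show "integrable lborel ?g"
    using powr_integral_from_0[of a 1] powr_integral_to_infinity[of "1/2 - a" 1] a
    by (intro Bochner_Integration.integrable_add integrable_mult_left) (auto simp: has_bochner_integral_iff)
  show "envelope \<in> borel_measurable lborel" unfolding envelope_def[abs_def] by measurable
  have "envelope t \<le> ?g t" for t
  proof (cases "0 < t")
    case True
    have m: "min (L * n) (M * (n + 1) / sqrt t) \<le> L * n" "min (L * n) (M * (n + 1) / sqrt t) \<le> M * (n + 1) / sqrt t" by auto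
    have p: "t powr (- (1/2 - a) - 1) = t powr (a - 1) / sqrt t"
    proof -
      have "- (1/2 - a) - 1 = (a - 1) - 1/2" by simp
      then show ?thesis using True by (simp only: powr_diff) (simp add: powr_half_sqrt)
    qed
    have nn: "0 \<le> L * n" "0 \<le> M * (n + 1)" using L0 M0 n by auto
    show ?thesis
    proof (cases "t \<le> 1")
      case t1: True
      have "envelope t \<le> t powr (a - 1) * (L * n)"
        using True by (simp add: envelope_def mult_left_mono)
      moreover have "0 \<le> indicator {1..} t * t powr (- (1/2 - a) - 1) * (M * (n + 1))" using nn by simp
      ultimately show ?thesis using True t1 by simp
    next
      case t1: False
      have "envelope t \<le> t powr (a - 1) * (M * (n + 1) / sqrt t)"
        using mult_left_mono[OF m(2), of "t powr (a - 1)"] True by (simp add: envelope_def)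
      then show ?thesis using True t1 p by simp
    qed
  next
    case False
    then show ?thesis using L0 M0 n by (auto simp: envelope_def)
  qed
  then show "AE t in lborel. norm (envelope t) \<le> norm (?g t)"
    using envelope_nonneg by (intro AE_I2) (simp add: order.trans[OF _ abs_ge_self])
qed

lemma flow_bound:
  assumes t: "0 < t"
  shows "(\<integral>\<^sup>+z. ennreal (norm ((u y - u z) *\<^sub>R hgrad t (y - z))) \<partial>lborel)
      \<le> ennreal (min (L * n) (M * (n + 1) / sqrt t))"
proof -
  have "(\<integral>\<^sup>+z. ennreal (norm ((u y - u z) *\<^sub>R hgrad t (y - z))) \<partial>lborel)
      \<le> (\<integral>\<^sup>+z. ennreal L * ennreal (norm (y - z) * norm (hgrad t (y - z))) \<partial>lborel)"
    using L0 mult_right_mono[OF lipschitz norm_ge_zero]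
    by (intro nn_integral_mono) (auto simp: ennreal_mult''[symmetric] mult.assoc intro!: ennreal_leI)
  also have "\<dots> = ennreal L * (\<integral>\<^sup>+z. ennreal (norm (y - z) * norm (hgrad t (y - z))) \<partial>lborel)"
    by (rule nn_integral_cmult) measurable
  also have "(\<integral>\<^sup>+z. ennreal (norm (y - z) * norm (hgrad t (y - z))) \<partial>lborel) = ennreal n"
    unfolding n_def nn_integral_norm_times_hgrad[OF t, where 'a='a, symmetric]
    by (rule nn_integral_lborel_diff) measurable
  also have "ennreal L * ennreal n = ennreal (L * n)"
    using L0 by (simp add: ennreal_mult')
  finally have 1: "(\<integral>\<^sup>+z. ennreal (norm ((u y - u z) *\<^sub>R hgrad t (y - z))) \<partial>lborel) \<le> ennreal (L * n)" .
  have "\<bar>u y - u z\<bar> \<le> 2 * M" for z using bound[of y] bound[of z] by linarith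
  then have "(\<integral>\<^sup>+z. ennreal (norm ((u y - u z) *\<^sub>R hgrad t (y - z))) \<partial>lborel)
      \<le> (\<integral>\<^sup>+z. ennreal (2 * M) * ennreal (norm (hgrad t (y - z))) \<partial>lborel)"
    using M0 by (intro nn_integral_mono) (auto simp: ennreal_mult''[symmetric] intro!: ennreal_leI mult_right_mono)
  also have "\<dots> = ennreal (2 * M) * (\<integral>\<^sup>+w. ennreal (norm (hgrad t (w::'a))) \<partial>lborel)"
    using nn_integral_lborel_diff[of "\<lambda>w. ennreal (norm (hgrad t w))" y]
    by (simp add: nn_integral_cmult)
  also have "\<dots> \<le> ennreal (2 * M) * ennreal ((n + 1) / (2 * sqrt t))"
    using nn_integral_norm_hgrad[OF t, where 'a='a] unfolding n_def by (rule mult_left_mono) simp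
  also have "\<dots> = ennreal (M * (n + 1) / sqrt t)"
    using M0 n t by (simp add: ennreal_mult''[symmetric])
  finally show ?thesis using 1 by (auto simp: min_def)
qed

lemma flow_measurable [measurable (raw)]:
  assumes [measurable]: "f \<in> borel_measurable N" "g \<in> borel_measurable N"
  shows "(\<lambda>x. flow (f x) (g x)) \<in> borel_measurable N"
  unfolding flow_def by measurable

lemma norm_flow_le: "(indicator {0<..} t * t powr (a - 1)) * norm (flow t y) \<le> envelope t"
proof (cases "0 < t")
  case True
  have "norm (flow t y) \<le> min (L * n) (M * (n + 1) / sqrt t)"
  proof (cases "integrable lborel (\<lambda>z. (u y - u z) *\<^sub>R hgrad t (y - z))")
    case int: True
    have "ennreal (norm (flow t y)) \<le> (\<integral>\<^sup>+z. ennreal (norm ((u y - u z) *\<^sub>R hgrad t (y - z))) \<partial>lborel)"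
      unfolding flow_def by (rule integral_norm_bound_ennreal[OF int])
    also note flow_bound[OF True]
    finally show ?thesis using L0 M0 n True by (subst (asm) ennreal_le_iff) auto
  next
    case False
    then show ?thesis using L0 M0 n True by (simp add: flow_def not_integrable_integral_eq)
  qed
  then show ?thesis using True by (simp add: envelope_def mult_left_mono)
qed (simp add: envelope_def)

lemma integrable_flow: "integrable lborel (\<lambda>t. (indicator {0<..} t * t powr (a - 1)) *\<^sub>R flow t y)"
  by (rule Bochner_Integration.integrable_bound[OF integrable_envelope])
    (use norm_flow_le[of _ y] envelope_nonneg in auto)

text \<open>Time and space integrals are exchanged under the envelope; the inner time integral is
  \<open>hgrad_subordination\<close> with w = y - z.\<close>

lemma frac_grad_smooth_eq:
  "Gamma a *\<^sub>R frac_grad_smooth s u y = (LINT t|lborel. (indicator {0<..} t * t powr (a - 1)) *\<^sub>R flow t y)"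
proof -
  let ?f = "\<lambda>t z. (indicator {0<..} t * t powr (a - 1)) *\<^sub>R ((u y - u z) *\<^sub>R hgrad t (y - z))"
  have "(LINT t|lborel. (indicator {0<..} t * t powr (a - 1)) *\<^sub>R flow t y) =
      (LINT t|lborel. LINT z|lborel. ?f t z)"
    unfolding flow_def integral_scaleR_right ..
  also have "\<dots> = (LINT z|lborel. LINT t|lborel. ?f t z)"
  proof (rule fubini_dominated[OF _ integrable_envelope])
    fix t :: real
    show "(\<integral>\<^sup>+z. ennreal (norm (?f t z)) \<partial>lborel) \<le> ennreal (envelope t)"
    proof (cases "0 < t")
      case True
      have "(\<integral>\<^sup>+z. ennreal (norm (?f t z)) \<partial>lborel) =
          ennreal (t powr (a - 1)) * (\<integral>\<^sup>+z. ennreal (norm ((u y - u z) *\<^sub>R hgrad t (y - z))) \<partial>lborel)"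
        using True by (subst nn_integral_cmult[symmetric]) (auto simp: ennreal_mult''[symmetric] mult.assoc abs_mult)
      also have "\<dots> \<le> ennreal (t powr (a - 1)) * ennreal (min (L * n) (M * (n + 1) / sqrt t))"
        by (rule mult_left_mono[OF flow_bound[OF True]]) simp
      also have "\<dots> = ennreal (envelope t)"
        using True L0 M0 n by (simp add: envelope_def ennreal_mult''[symmetric])
      finally show ?thesis .
    qed simp
  qed measurable
  also have "\<dots> = (LINT z|lborel. (Gamma a * frac_const DIM('a) s) *\<^sub>R
      (((u y - u z) / norm (y - z) powr (real DIM('a) + s)) *\<^sub>R ((y - z) /\<^sub>R norm (y - z))))"
  proof (intro Bochner_Integration.integral_cong refl)
    fix z
    show "(LINT t|lborel. ?f t z) = (Gamma a * frac_const DIM('a) s) *\<^sub>R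
      (((u y - u z) / norm (y - z) powr (real DIM('a) + s)) *\<^sub>R ((y - z) /\<^sub>R norm (y - z)))"
    proof (cases "y = z")
      case False
      have "has_bochner_integral lborel (\<lambda>t. (u y - u z) *\<^sub>R ((indicator {0<..} t * t powr (a - 1)) *\<^sub>R hgrad t (y - z)))
         ((u y - u z) *\<^sub>R ((Gamma a * frac_const DIM('a) s / norm (y - z) powr (real DIM('a) + s)) *\<^sub>R ((y - z) /\<^sub>R norm (y - z))))"
        unfolding a_def using s False by (intro has_bochner_integral_scaleR_right hgrad_subordination) auto
      from has_bochner_integral_integral_eq[OF this] show ?thesis by (simp add: mult_ac)
    qed simp
  qed
  also have "\<dots> = Gamma a *\<^sub>R frac_grad_smooth s u y"
    unfolding integral_scaleR_right frac_grad_smooth_def by simp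
  finally show ?thesis ..
qed

abbreviation D :: "'a \<Rightarrow> 'a" where "D \<equiv> frac_grad_smooth s u"

lemma D_measurable [measurable]: "D \<in> borel_measurable borel"
  unfolding frac_grad_smooth_def[abs_def] by measurable

text \<open>The envelope does not depend on y. Boundedness makes the convolution of
  \<open>hgrad_mean\<close> with |D| finite at every point, not just almost everywhere.\<close>

lemma D_bounded: "\<exists>K. \<forall>y. norm (D y) \<le> K"
proof (intro exI allI)
  fix y
  have "Gamma a * norm (D y) = norm (Gamma a *\<^sub>R D y)" using Gamma_real_pos[OF a(1)] by simp
  also have "\<dots> \<le> (LINT t|lborel. norm ((indicator {0<..} t * t powr (a - 1)) *\<^sub>R flow t y))"
    unfolding frac_grad_smooth_eq by (rule integral_norm_bound)
  also have "\<dots> \<le> integral\<^sup>L lborel envelope"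
    using norm_flow_le[of _ y] by (intro integral_mono integrable_envelope integrable_norm integrable_flow) (auto simp: abs_mult)
  finally show "norm (D y) \<le> integral\<^sup>L lborel envelope / Gamma a"
    using Gamma_real_pos[OF a(1)] by (simp add: field_simps)
qed

section \<open>Heat evolution of the test function\<close>

definition evol :: "real \<Rightarrow> 'a \<Rightarrow> real" where
  "evol r x = (LINT z|lborel. u z * heat r (x - z))"
definition devol :: "real \<Rightarrow> 'a \<Rightarrow> real" where
  "devol r x = (LINT z|lborel. u z * dheat r (x - z))"

lemma devol_measurable [measurable (raw)]:
  assumes [measurable]: "f \<in> borel_measurable N" "g \<in> borel_measurable N"
  shows "(\<lambda>x. devol (f x) (g x)) \<in> borel_measurable N"
  unfolding devol_def by measurable

lemma nn_integral_u_hgrad: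
  assumes t: "0 < t"
  shows "(\<integral>\<^sup>+z. ennreal (norm (u z *\<^sub>R hgrad t (y - z))) \<partial>lborel) \<le> ennreal (M * ((n + 1) / (2 * sqrt t)))"
proof -
  have "(\<integral>\<^sup>+z. ennreal (norm (u z *\<^sub>R hgrad t (y - z))) \<partial>lborel)
      \<le> (\<integral>\<^sup>+z. ennreal M * ennreal (norm (hgrad t (y - z))) \<partial>lborel)"
    using M0 bound by (intro nn_integral_mono) (auto simp: ennreal_mult''[symmetric] intro!: ennreal_leI mult_right_mono)
  also have "\<dots> = ennreal M * (\<integral>\<^sup>+w. ennreal (norm (hgrad t (w::'a))) \<partial>lborel)"
    using nn_integral_lborel_diff[of "\<lambda>w. ennreal (norm (hgrad t w))" y]
    by (simp add: nn_integral_cmult)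
  also have "\<dots> \<le> ennreal M * ennreal ((n + 1) / (2 * sqrt t))"
    using nn_integral_norm_hgrad[OF t, where 'a='a] unfolding n_def by (rule mult_left_mono) simp
  also have "\<dots> = ennreal (M * ((n + 1) / (2 * sqrt t)))"
    by (rule ennreal_mult'[OF M0, symmetric])
  finally show ?thesis .
qed

lemma integrable_u_hgrad: "0 < t \<Longrightarrow> integrable lborel (\<lambda>z. u z *\<^sub>R hgrad t (y - z))"
  using nn_integral_u_hgrad[of t y]
  by (intro integrableI_bounded) (auto intro: le_less_trans)

lemma flow_eq:
  assumes t: "0 < t"
  shows "flow t y = - (LINT z|lborel. u z *\<^sub>R hgrad t (y - z))"
proof -
  have h: "has_bochner_integral lborel (\<lambda>z. hgrad t (y - z)) 0"
    by (rule has_bochner_integral_lborel_diff[OF hgrad_integral_0[OF t]])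
  have "flow t y = (LINT z|lborel. u y *\<^sub>R hgrad t (y - z) - u z *\<^sub>R hgrad t (y - z))"
    unfolding flow_def by (simp add: scaleR_diff_left)
  also have "\<dots> = u y *\<^sub>R (LINT z|lborel. hgrad t (y - z)) - (LINT z|lborel. u z *\<^sub>R hgrad t (y - z))"
    using h integrable_u_hgrad[OF t, of y]
    by (subst Bochner_Integration.integral_diff) (auto simp: has_bochner_integral_iff)
  finally show ?thesis using h by (simp add: has_bochner_integral_iff)
qed

lemma integrable_hgrad_diff: "0 < t \<Longrightarrow> integrable lborel (\<lambda>y::'a. hgrad t (x - y))"
  using has_bochner_integral_lborel_diff[OF hgrad_integral_0, of t x] by (auto simp: has_bochner_integral_iff)

text \<open>The identity \<open>hgrad_convolution\<close> integrated against u, after an exchange of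
  integrals; the minus sign is that of \<open>flow_eq\<close>.\<close>

lemma hgrad_flow_integral:
  assumes \<tau>: "0 < \<tau>" and t: "0 < t"
  shows "(LINT y|lborel. hgrad \<tau> (x - y) \<bullet> flow t y) = - devol (\<tau> + t) x"
proof -
  let ?c = "M * ((n + 1) / (2 * sqrt t))"
  have "(LINT y|lborel. hgrad \<tau> (x - y) \<bullet> flow t y) =
     (LINT y|lborel. - (LINT z|lborel. hgrad \<tau> (x - y) \<bullet> (u z *\<^sub>R hgrad t (y - z))))"
    using integrable_u_hgrad[OF t]
    by (intro Bochner_Integration.integral_cong refl) (simp add: flow_eq[OF t] integral_inner_right del: inner_scaleR_right)
  also have "\<dots> = - (LINT y|lborel. LINT z|lborel. hgrad \<tau> (x - y) \<bullet> (u z *\<^sub>R hgrad t (y - z)))"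
    by simp
  also have "(LINT y|lborel. LINT z|lborel. hgrad \<tau> (x - y) \<bullet> (u z *\<^sub>R hgrad t (y - z))) =
      (LINT z|lborel. LINT y|lborel. hgrad \<tau> (x - y) \<bullet> (u z *\<^sub>R hgrad t (y - z)))"
  proof (rule fubini_dominated[where m = "\<lambda>y. norm (hgrad \<tau> (x - y)) * ?c"])
    show "integrable lborel (\<lambda>y. norm (hgrad \<tau> (x - y)) * ?c)"
      by (intro integrable_mult_left integrable_norm integrable_hgrad_diff \<tau>)
    fix y
    have "(\<integral>\<^sup>+z. ennreal (norm (hgrad \<tau> (x - y) \<bullet> (u z *\<^sub>R hgrad t (y - z)))) \<partial>lborel)
      \<le> (\<integral>\<^sup>+z. ennreal (norm (hgrad \<tau> (x - y))) * ennreal (norm (u z *\<^sub>R hgrad t (y - z))) \<partial>lborel)"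
      unfolding real_norm_def
      by (intro nn_integral_mono) (auto simp del: inner_scaleR_right norm_scaleR simp: ennreal_mult''[symmetric]
         intro!: ennreal_leI Cauchy_Schwarz_ineq2)
    also have "\<dots> = ennreal (norm (hgrad \<tau> (x - y))) * (\<integral>\<^sup>+z. ennreal (norm (u z *\<^sub>R hgrad t (y - z))) \<partial>lborel)"
      by (rule nn_integral_cmult) measurable
    also have "\<dots> \<le> ennreal (norm (hgrad \<tau> (x - y))) * ennreal ?c"
      by (rule mult_left_mono[OF nn_integral_u_hgrad[OF t]]) simp
    finally show "(\<integral>\<^sup>+z. ennreal (norm (hgrad \<tau> (x - y) \<bullet> (u z *\<^sub>R hgrad t (y - z)))) \<partial>lborel)
      \<le> ennreal (norm (hgrad \<tau> (x - y)) * ?c)"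
      unfolding ennreal_mult'[OF norm_ge_zero] .
  qed measurable
  also have "\<dots> = devol (\<tau> + t) x"
    unfolding devol_def
    using hgrad_convolution[OF \<tau> t, of x]
    by (intro Bochner_Integration.integral_cong refl) (simp add: has_bochner_integral_iff)
  finally show ?thesis .
qed

lemma hgrad_D_integral:
  assumes \<tau>: "0 < \<tau>"
  shows "Gamma a * (LINT y|lborel. hgrad \<tau> (x - y) \<bullet> D y) =
    - (LINT t|lborel. indicator {0<..} t * t powr (a - 1) * devol (\<tau> + t) x)"
proof -
  let ?f = "\<lambda>t y. hgrad \<tau> (x - y) \<bullet> ((indicator {0<..} t * t powr (a - 1)) *\<^sub>R flow t y)"
  let ?c = "LINT y|lborel. norm (hgrad \<tau> (x - y))"
  have "Gamma a * (LINT y|lborel. hgrad \<tau> (x - y) \<bullet> D y) =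
      (LINT y|lborel. hgrad \<tau> (x - y) \<bullet> (Gamma a *\<^sub>R D y))"
    by simp
  also have "\<dots> = (LINT y|lborel. LINT t|lborel. ?f t y)"
    unfolding frac_grad_smooth_eq
    by (intro Bochner_Integration.integral_cong refl integral_inner_right[symmetric] integrable_flow)
  also have "\<dots> = (LINT t|lborel. LINT y|lborel. ?f t y)"
  proof (rule fubini_dominated[where m = "\<lambda>t. envelope t * ?c", symmetric])
    show "integrable lborel (\<lambda>t. envelope t * ?c)"
      by (intro integrable_mult_left integrable_envelope)
    fix t :: real
    have "(\<integral>\<^sup>+y. ennreal (norm (?f t y)) \<partial>lborel) \<le> (\<integral>\<^sup>+y. ennreal (envelope t) * ennreal (norm (hgrad \<tau> (x - y))) \<partial>lborel)"
    proof (intro nn_integral_mono)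
      fix y
      have "norm (?f t y) \<le> norm (hgrad \<tau> (x - y)) * norm ((indicator {0<..} t * t powr (a - 1)) *\<^sub>R flow t y)"
        unfolding real_norm_def by (rule Cauchy_Schwarz_ineq2)
      also have "\<dots> \<le> norm (hgrad \<tau> (x - y)) * envelope t"
        using norm_flow_le[of t y] by (intro mult_left_mono) (auto simp: abs_mult)
      also have "\<dots> = envelope t * norm (hgrad \<tau> (x - y))" by (rule mult.commute)
      finally show "ennreal (norm (?f t y)) \<le> ennreal (envelope t) * ennreal (norm (hgrad \<tau> (x - y)))"
        unfolding ennreal_mult''[OF norm_ge_zero, symmetric] by (rule ennreal_leI)
    qed
    also have "\<dots> = ennreal (envelope t) * (\<integral>\<^sup>+y. ennreal (norm (hgrad \<tau> (x - y))) \<partial>lborel)"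
      by (rule nn_integral_cmult) measurable
    also have "(\<integral>\<^sup>+y. ennreal (norm (hgrad \<tau> (x - y))) \<partial>lborel) = ennreal ?c"
      by (intro nn_integral_eq_integral integrable_norm integrable_hgrad_diff \<tau>) simp
    finally show "(\<integral>\<^sup>+y. ennreal (norm (?f t y)) \<partial>lborel) \<le> ennreal (envelope t * ?c)"
      by (simp add: ennreal_mult'' del: inner_scaleR_right)
  qed measurable
  also have "\<dots> = (LINT t|lborel. - (indicator {0<..} t * t powr (a - 1) * devol (\<tau> + t) x))"
  proof (intro Bochner_Integration.integral_cong refl)
    fix t :: real
    show "(LINT y|lborel. ?f t y) = - (indicator {0<..} t * t powr (a - 1) * devol (\<tau> + t) x)"
      using hgrad_flow_integral[OF \<tau>, of t x] by (cases "0 < t") auto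
  qed
  finally show ?thesis by simp
qed

text \<open>The power \<tau>^(-a) in the truncated kernel is chosen for this: t = \<tau> v produces
  \<tau> * \<tau>^(a-1), and after cancellation \<tau> occurs only in \<tau> (1 + v). The
  \<tau>-integral can then be evaluated for each v separately.\<close>

lemma hgrad_D_integral_scaled:
  assumes \<tau>: "0 < \<tau>"
  shows "\<tau> powr - a * (Gamma a * (LINT y|lborel. hgrad \<tau> (x - y) \<bullet> D y)) =
    - (LINT v|lborel. indicator {0<..} v * v powr (a - 1) * devol (\<tau> * (1 + v)) x)"
proof -
  have "(LINT t|lborel. indicator {0<..} t * t powr (a - 1) * devol (\<tau> + t) x) =
    \<tau> * (LINT v|lborel. indicator {0<..} (\<tau> * v) * (\<tau> * v) powr (a - 1) * devol (\<tau> + \<tau> * v) x)"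
    using \<tau> lborel_integral_real_affine[of \<tau> "\<lambda>t. indicator {0<..} t * t powr (a - 1) * devol (\<tau> + t) x" 0] by simp
  also have "\<dots> = \<tau> * (LINT v|lborel. \<tau> powr (a - 1) * (indicator {0<..} v * v powr (a - 1) * devol (\<tau> * (1 + v)) x))"
  proof (rule arg_cong[where f = "(*) \<tau>"], rule Bochner_Integration.integral_cong[OF refl])
    fix v :: real
    have "\<tau> + \<tau> * v = \<tau> * (1 + v)" by (simp add: algebra_simps)
    moreover have "(indicator {0<..} (\<tau> * v) :: real) = indicator {0<..} v"
      using \<tau> by (simp add: indicator_def zero_less_mult_iff)
    ultimately show "indicator {0<..} (\<tau> * v) * (\<tau> * v) powr (a - 1) * devol (\<tau> + \<tau> * v) x =
       \<tau> powr (a - 1) * (indicator {0<..} v * v powr (a - 1) * devol (\<tau> * (1 + v)) x)"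
      by (simp add: powr_mult)
  qed
  also have "\<dots> = (\<tau> * \<tau> powr (a - 1)) * (LINT v|lborel. indicator {0<..} v * v powr (a - 1) * devol (\<tau> * (1 + v)) x)"
    by simp
  also have "\<tau> * \<tau> powr (a - 1) = \<tau> powr a"
    using \<tau> by (simp add: powr_mult_base)
  finally have "Gamma a * (LINT y|lborel. hgrad \<tau> (x - y) \<bullet> D y) =
     - (\<tau> powr a * (LINT v|lborel. indicator {0<..} v * v powr (a - 1) * devol (\<tau> * (1 + v)) x))"
    unfolding hgrad_D_integral[OF \<tau>] by simp
  moreover have "\<tau> powr - a * \<tau> powr a = 1" using \<tau> by (simp add: powr_add[symmetric])
  ultimately show ?thesis by (simp add: mult.assoc[symmetric])
qed

lemma nn_integral_u_dheat:
  assumes r: "0 < r"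
  shows "(\<integral>\<^sup>+z. ennreal (norm (u z * dheat r (x - z))) \<partial>lborel) \<le> ennreal (M * n / r)"
proof -
  have "(\<integral>\<^sup>+z. ennreal (norm (u z * dheat r (x - z))) \<partial>lborel)
      \<le> (\<integral>\<^sup>+z. ennreal M * ennreal (norm (dheat r (x - z))) \<partial>lborel)"
    using M0 bound by (intro nn_integral_mono)
      (auto simp: ennreal_mult''[symmetric] abs_mult intro!: ennreal_leI mult_right_mono)
  also have "\<dots> = ennreal M * (\<integral>\<^sup>+w. ennreal (norm (dheat r (w::'a))) \<partial>lborel)"
    using nn_integral_lborel_diff[of "\<lambda>w. ennreal (norm (dheat r w))" x]
    by (simp add: nn_integral_cmult)
  also have "\<dots> \<le> ennreal M * ennreal (n / r)"
    using nn_integral_dheat[OF r, where 'a='a] unfolding n_def by (rule mult_left_mono) simp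
  also have "\<dots> = ennreal (M * n / r)"
    using M0 by (simp add: ennreal_mult'[symmetric])
  finally show ?thesis .
qed

lemma devol_bound:
  assumes r: "0 < r"
  shows "\<bar>devol r x\<bar> \<le> M * n / r"
proof (cases "integrable lborel (\<lambda>z. u z * dheat r (x - z))")
  case True
  have "ennreal (norm (devol r x)) \<le> (\<integral>\<^sup>+z. ennreal (norm (u z * dheat r (x - z))) \<partial>lborel)"
    unfolding devol_def by (rule integral_norm_bound_ennreal[OF True])
  also note nn_integral_u_dheat[OF r]
  finally show ?thesis using M0 n r by (subst (asm) ennreal_le_iff) auto
next
  case False
  then show ?thesis using M0 n r by (simp add: devol_def not_integrable_integral_eq)
qed

lemma integrable_u_heat:
  assumes "0 < r"
  shows "integrable lborel (\<lambda>z. u z * heat r (x - z))"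
proof (rule Bochner_Integration.integrable_bound)
  show "integrable lborel (\<lambda>z. (4 * pi * r) powr (- real DIM('a) / 2) * norm (u z))"
    using int_u by simp
  show "AE z in lborel. norm (u z * heat r (x - z)) \<le> norm ((4 * pi * r) powr (- real DIM('a) / 2) * norm (u z))"
  proof (intro AE_I2)
    fix z
    have "norm (u z) * heat r (x - z) \<le> norm (u z) * (4 * pi * r) powr (- real DIM('a) / 2)"
      by (rule mult_left_mono[OF heat_le[OF assms]]) simp
    then show "norm (u z * heat r (x - z)) \<le> norm ((4 * pi * r) powr (- real DIM('a) / 2) * norm (u z))"
      by (simp add: abs_mult heat_nonneg mult.commute)
  qed
qed measurable

text \<open>On [\<epsilon>, T] the bound of \<open>nn_integral_u_dheat\<close> is at most the
  constant M n / (\<epsilon> c), so \<open>dheat_integral\<close> may be applied under the space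
  integral.\<close>

lemma devol_integral:
  assumes \<epsilon>: "0 < \<epsilon>" "\<epsilon> \<le> T" and c: "0 < c"
  shows "(LINT \<tau>|lborel. indicator {\<epsilon>..T} \<tau> * devol (\<tau> * c) x) = (evol (T * c) x - evol (\<epsilon> * c) x) / c"
proof -
  let ?f = "\<lambda>\<tau> z. indicator {\<epsilon>..T} \<tau> * (u z * dheat (\<tau> * c) (x - z))"
  let ?m = "\<lambda>\<tau>. indicator {\<epsilon>..T} \<tau> * (M * n / (\<epsilon> * c))"
  have "(LINT \<tau>|lborel. indicator {\<epsilon>..T} \<tau> * devol (\<tau> * c) x) = (LINT \<tau>|lborel. LINT z|lborel. ?f \<tau> z)"
    unfolding devol_def by simp
  also have "\<dots> = (LINT z|lborel. LINT \<tau>|lborel. ?f \<tau> z)"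
  proof (rule fubini_dominated[where m = ?m])
    have "integrable lborel (indicator {\<epsilon>..T} :: real \<Rightarrow> real)"
      by (rule integrable_real_indicator) (use \<epsilon> in auto)
    then show "integrable lborel ?m" by (rule integrable_mult_left)
    fix \<tau>
    show "(\<integral>\<^sup>+z. ennreal (norm (?f \<tau> z)) \<partial>lborel) \<le> ennreal (?m \<tau>)"
    proof (cases "\<tau> \<in> {\<epsilon>..T}")
      case True
      then have "(\<integral>\<^sup>+z. ennreal (norm (?f \<tau> z)) \<partial>lborel) \<le> ennreal (M * n / (\<tau> * c))"
        using nn_integral_u_dheat[of "\<tau> * c" x] \<epsilon> c by simp
      also have "\<dots> \<le> ennreal (M * n / (\<epsilon> * c))"
        using True \<epsilon> c M0 n by (intro ennreal_leI divide_left_mono) auto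
      finally show ?thesis using True by simp
    qed simp
  qed measurable
  also have "\<dots> = (LINT z|lborel. (u z * heat (T * c) (x - z) - u z * heat (\<epsilon> * c) (x - z)) / c)"
  proof (intro Bochner_Integration.integral_cong refl)
    fix z
    have "(LINT \<tau>|lborel. ?f \<tau> z) = u z * (LINT \<tau>|lborel. dheat (\<tau> * c) (x - z) * indicator {\<epsilon>..T} \<tau>)"
      by (subst integral_mult_right_zero[symmetric]) (simp add: mult_ac)
    then show "(LINT \<tau>|lborel. ?f \<tau> z) = (u z * heat (T * c) (x - z) - u z * heat (\<epsilon> * c) (x - z)) / c"
      unfolding dheat_integral[OF \<epsilon> c] by (simp add: right_diff_distrib)
  qed
  also have "\<dots> = (evol (T * c) x - evol (\<epsilon> * c) x) / c"
    using \<epsilon> c unfolding evol_def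
    by (simp add: Bochner_Integration.integral_diff integrable_u_heat)
  finally show ?thesis .
qed

text \<open>Since G_r has mass 1, the error is an average of u z - u x, at most L times the first
  moment. The rate sqrt r is what later removes the cutoff.\<close>

lemma evol_approx:
  assumes r: "0 < r"
  shows "\<bar>evol r x - u x\<bar> \<le> L * (n + 1) * sqrt r"
proof -
  have h: "has_bochner_integral lborel (\<lambda>z. heat r (x - z)) 1"
    by (rule has_bochner_integral_lborel_diff[OF heat_mass[OF r]])
  have m: "has_bochner_integral lborel (\<lambda>z. norm (x - z) * heat r (x - z)) (LINT w|lborel. norm (w::'a) * heat r w)"
    by (rule has_bochner_integral_lborel_diff[where f = "\<lambda>w. norm w * heat r w"])
      (rule has_bochner_integral_integrable[OF heat_first_moment(1)[OF r]])
  have "evol r x - u x = (LINT z|lborel. u z * heat r (x - z) - u x * heat r (x - z))"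
    using h integrable_u_heat[OF r, of x] unfolding evol_def
    by (subst Bochner_Integration.integral_diff) (auto simp: has_bochner_integral_iff)
  also have "\<bar>\<dots>\<bar> \<le> (LINT z|lborel. L * (norm (x - z) * heat r (x - z)))"
  proof (rule integral_abs_bound[THEN order.trans], rule integral_mono)
    show "integrable lborel (\<lambda>z. \<bar>u z * heat r (x - z) - u x * heat r (x - z)\<bar>)"
      using h integrable_u_heat[OF r, of x] by (auto simp: has_bochner_integral_iff)
    show "integrable lborel (\<lambda>z. L * (norm (x - z) * heat r (x - z)))"
      using m by (auto simp: has_bochner_integral_iff)
    fix z
    have "\<bar>u z * heat r (x - z) - u x * heat r (x - z)\<bar> = \<bar>u z - u x\<bar> * heat r (x - z)"
      by (simp add: left_diff_distrib[symmetric] abs_mult heat_nonneg)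
    also have "\<dots> \<le> L * norm (z - x) * heat r (x - z)"
      by (rule mult_right_mono[OF lipschitz heat_nonneg])
    finally show "\<bar>u z * heat r (x - z) - u x * heat r (x - z)\<bar> \<le> L * (norm (x - z) * heat r (x - z))"
      by (simp add: norm_minus_commute mult.assoc)
  qed
  also have "\<dots> = L * (LINT w|lborel. norm (w::'a) * heat r w)"
    using m by (simp add: has_bochner_integral_iff)
  also have "\<dots> \<le> L * ((n + 1) * sqrt r)"
    using heat_first_moment(2)[OF r, where 'a='a] L0 unfolding n_def by (rule mult_left_mono)
  finally show ?thesis by (simp add: mult.assoc)
qed

lemma evol_bound:
  assumes r: "0 < r"
  shows "\<bar>evol r x\<bar> \<le> (4 * pi * r) powr (- n / 2) * (LINT z|lborel. \<bar>u z\<bar>)"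
proof -
  have "\<bar>evol r x\<bar> \<le> (LINT z|lborel. (4 * pi * r) powr (- n / 2) * \<bar>u z\<bar>)"
    unfolding evol_def
  proof (rule integral_abs_bound[THEN order.trans], rule integral_mono)
    show "\<bar>u z * heat r (x - z)\<bar> \<le> (4 * pi * r) powr (- n / 2) * \<bar>u z\<bar>" for z
    proof -
      have "\<bar>u z\<bar> * heat r (x - z) \<le> \<bar>u z\<bar> * (4 * pi * r) powr (- n / 2)"
        unfolding n_def by (rule mult_left_mono[OF heat_le[OF r]]) simp
      then show ?thesis by (simp add: abs_mult heat_nonneg mult.commute)
    qed
  qed (use int_u integrable_u_heat[OF r, of x] in auto)
  then show ?thesis by simp
qed

end

section \<open>The pointwise estimate\<close>

text \<open>The norm stands inside the time integral, so this dominates the truncated kernel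
  together with all its cutoffs near time 0. Values in \<open>ennreal\<close> let Tonelli be used
  without side conditions.\<close>

definition hgrad_mean :: "real \<Rightarrow> real \<Rightarrow> 'a::euclidean_space \<Rightarrow> ennreal" where
  "hgrad_mean a T w = (\<integral>\<^sup>+\<tau>. ennreal (indicator {0<..T} \<tau> * \<tau> powr - a) * ennreal (norm (hgrad \<tau> w)) \<partial>lborel)"

lemma hgrad_mean_measurable [measurable (raw)]:
  assumes [measurable]: "g \<in> borel_measurable N"
  shows "(\<lambda>x. hgrad_mean a T (g x :: 'a::euclidean_space)) \<in> borel_measurable N"
  unfolding hgrad_mean_def by measurable

text \<open>The time exponents add up to - a - 1/2 = s / 2 - 1, whose integral over [0, T] is 2
  T^(s/2) / s. This is the sole source of the factor 1 / s in the theorem.\<close>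

lemma nn_integral_hgrad_mean:
  assumes s: "0 < s" "s < 1" and T: "0 < T"
  shows "(\<integral>\<^sup>+w. hgrad_mean ((1 - s) / 2) T (w::'a::euclidean_space) \<partial>lborel)
    \<le> ennreal ((real DIM('a) + 1) / s * T powr (s / 2))"
proof -
  let ?a = "(1 - s) / 2" and ?n = "real DIM('a)"
  have "(\<integral>\<^sup>+w. hgrad_mean ?a T (w::'a) \<partial>lborel) =
    (\<integral>\<^sup>+\<tau>. \<integral>\<^sup>+w. ennreal (indicator {0<..T} \<tau> * \<tau> powr - ?a) * ennreal (norm (hgrad \<tau> (w::'a))) \<partial>lborel \<partial>lborel)"
    unfolding hgrad_mean_def by (rule lborel_pair.Fubini') measurable
  also have "\<dots> = (\<integral>\<^sup>+\<tau>. ennreal (indicator {0<..T} \<tau> * \<tau> powr - ?a) * (\<integral>\<^sup>+w. ennreal (norm (hgrad \<tau> (w::'a))) \<partial>lborel) \<partial>lborel)"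
    by (subst nn_integral_cmult) auto
  also have "\<dots> \<le> (\<integral>\<^sup>+\<tau>. ennreal ((?n + 1) / 2) * ennreal (indicator {0..T} \<tau> * \<tau> powr (s / 2 - 1)) \<partial>lborel)"
  proof (intro nn_integral_mono)
    fix \<tau> :: real
    show "ennreal (indicator {0<..T} \<tau> * \<tau> powr - ?a) * (\<integral>\<^sup>+w. ennreal (norm (hgrad \<tau> (w::'a))) \<partial>lborel)
       \<le> ennreal ((?n + 1) / 2) * ennreal (indicator {0..T} \<tau> * \<tau> powr (s / 2 - 1))"
    proof (cases "\<tau> \<in> {0<..T}")
      case True
      then have \<tau>: "0 < \<tau>" by simp
      have "ennreal (indicator {0<..T} \<tau> * \<tau> powr - ?a) * (\<integral>\<^sup>+w. ennreal (norm (hgrad \<tau> (w::'a))) \<partial>lborel)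
        \<le> ennreal (indicator {0<..T} \<tau> * \<tau> powr - ?a) * ennreal ((?n + 1) / (2 * sqrt \<tau>))"
        by (rule mult_left_mono[OF nn_integral_norm_hgrad[OF \<tau>]]) simp
      also have "\<dots> = ennreal (\<tau> powr - ?a * ((?n + 1) / (2 * sqrt \<tau>)))"
        using True by (subst ennreal_mult'[OF powr_ge_zero]) simp
      also have "\<tau> powr - ?a * ((?n + 1) / (2 * sqrt \<tau>)) = (?n + 1) / 2 * \<tau> powr (s / 2 - 1)"
      proof -
        have "s / 2 - 1 = - ?a - 1 / 2" by (simp add: field_simps)
        then have "\<tau> powr (s / 2 - 1) = \<tau> powr - ?a / sqrt \<tau>"
          using \<tau> by (simp only: powr_diff) (simp add: powr_half_sqrt)
        then show ?thesis by simp
      qed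
      also have "ennreal ((?n + 1) / 2 * \<tau> powr (s / 2 - 1)) = ennreal ((?n + 1) / 2) * ennreal (\<tau> powr (s / 2 - 1))"
        by (rule ennreal_mult') simp
      finally show ?thesis using True by simp
    qed simp
  qed
  also have "\<dots> = ennreal ((?n + 1) / 2) * (\<integral>\<^sup>+\<tau>. ennreal (indicator {0..T} \<tau> * \<tau> powr (s / 2 - 1)) \<partial>lborel)"
    by (rule nn_integral_cmult) measurable
  also have "(\<integral>\<^sup>+\<tau>. ennreal (indicator {0..T} \<tau> * \<tau> powr (s / 2 - 1)) \<partial>lborel) = ennreal (T powr (s / 2) / (s / 2))"
    using powr_integral_from_0[of "s / 2" T] s T
    by (subst nn_integral_eq_integral) (auto simp: has_bochner_integral_iff)
  also have "ennreal ((?n + 1) / 2) * ennreal (T powr (s / 2) / (s / 2)) = ennreal ((?n + 1) / s * T powr (s / 2))"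
    using s by (simp add: ennreal_mult'[symmetric])
  finally show ?thesis .
qed

context heat_test_function
begin

abbreviation weight :: "real \<Rightarrow> real" where
  "weight v \<equiv> indicator {0<..} v * v powr (a - 1)"

text \<open>The Beta value B(a, 1 - a), the total weight with which the evolutions at different
  times are mixed.\<close>

definition beta_const :: real where
  "beta_const = (LINT v|lborel. weight v / (1 + v))"

text \<open>The first integrand decays like v^(a-3/2), integrable as a < 1/2. It arises because
  \<open>evol_approx\<close> at time \<epsilon> (1 + v) loses a factor sqrt (1 + v).\<close>

lemma weight_integrable:
  shows "integrable lborel (\<lambda>v. weight v / sqrt (1 + v))" and "integrable lborel (\<lambda>v. weight v / (1 + v))"
proof -
  let ?g = "\<lambda>v. indicator {0..1} v * v powr (a - 1) + indicator {1..} v * v powr (- (1/2 - a) - 1)"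
  have g: "integrable lborel ?g"
    using powr_integral_from_0[of a 1] powr_integral_to_infinity[of "1/2 - a" 1] a
    by (intro Bochner_Integration.integrable_add) (auto simp: has_bochner_integral_iff)
  have 1: "weight v / sqrt (1 + v) \<le> ?g v" for v
  proof (cases "0 < v")
    case True
    have p: "v powr (- (1/2 - a) - 1) = v powr (a - 1) / sqrt v"
    proof -
      have "- (1/2 - a) - 1 = (a - 1) - 1/2" by simp
      then show ?thesis using True by (simp only: powr_diff) (simp add: powr_half_sqrt)
    qed
    have "v powr (a - 1) / sqrt (1 + v) \<le> v powr (a - 1) / 1"
      using True by (intro divide_left_mono) auto
    moreover have "v powr (a - 1) / sqrt (1 + v) \<le> v powr (a - 1) / sqrt v"
      using True by (intro divide_left_mono) auto
    ultimately show ?thesis using True unfolding p by (cases "v \<le> 1") (simp_all add: add_increasing2)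
  qed simp
  show int: "integrable lborel (\<lambda>v. weight v / sqrt (1 + v))"
  proof (rule Bochner_Integration.integrable_bound[OF g])
    show "AE v in lborel. norm (weight v / sqrt (1 + v)) \<le> norm (?g v)"
    proof (intro AE_I2)
      fix v :: real
      have "norm (weight v / sqrt (1 + v)) = weight v / sqrt (1 + v)" by (cases "0 < v") auto
      also have "\<dots> \<le> ?g v" by (rule 1)
      also have "\<dots> \<le> norm (?g v)" by simp
      finally show "norm (weight v / sqrt (1 + v)) \<le> norm (?g v)" .
    qed
  qed measurable
  show "integrable lborel (\<lambda>v. weight v / (1 + v))"
  proof (rule Bochner_Integration.integrable_bound[OF int])
    have "norm (weight v / (1 + v)) \<le> norm (weight v / sqrt (1 + v))" for v
    proof (cases "0 < v")
      case True
      have "sqrt (1 + v) \<le> 1 + v"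
        using True by (intro real_le_lsqrt) (auto simp: power2_eq_square algebra_simps)
      then show ?thesis using True by (simp add: divide_left_mono)
    qed simp
    then show "AE v in lborel. norm (weight v / (1 + v)) \<le> norm (weight v / sqrt (1 + v))" by simp
  qed measurable
qed

text \<open>Only v \<le> 1 is kept, where 1 + v \<le> 2. The resulting bound has the right order as
  a tends to 0, that is, as s tends to 1.\<close>

lemma beta_const_ge: "1 / (2 * a) \<le> beta_const"
proof -
  have h: "has_bochner_integral lborel (\<lambda>v. indicator {0..1} v * v powr (a - 1) / 2) (1 powr a / a / 2)"
    by (intro has_bochner_integral_divide_zero powr_integral_from_0) (use a in auto)
  have "(LINT v|lborel. indicator {0..1} v * v powr (a - 1) / 2) \<le> beta_const"
    unfolding beta_const_def
  proof (rule integral_mono)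
    fix v :: real
    show "indicator {0..1} v * v powr (a - 1) / 2 \<le> weight v / (1 + v)"
    proof (cases "0 < v \<and> v \<le> 1")
      case True
      then have "v powr (a - 1) / 2 \<le> v powr (a - 1) / (1 + v)"
        by (intro divide_left_mono) auto
      then show ?thesis using True by simp
    qed (auto simp: indicator_def)
  qed (use h weight_integrable in \<open>auto simp: has_bochner_integral_iff\<close>)
  then show ?thesis using h by (simp add: has_bochner_integral_iff mult.commute)
qed

lemma beta_const_pos: "0 < beta_const"
proof -
  have "0 < 1 / (2 * a)" using a by simp
  then show ?thesis using beta_const_ge by linarith
qed

text \<open>The cutoff \<open>\<epsilon>\<close> is needed for Fubini: the \<open>L\<^sup>1\<close> norm of \<open>\<partial>\<^sub>\<tau> G\<^sub>\<tau>\<close> is of order \<open>1 / \<tau>\<close>.\<close>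

lemma time_average_identity:
  assumes \<epsilon>: "0 < \<epsilon>" "\<epsilon> \<le> T"
  shows "(LINT \<tau>|lborel. indicator {\<epsilon>..T} \<tau> * (\<tau> powr - a * (Gamma a * (LINT y|lborel. hgrad \<tau> (x - y) \<bullet> D y)))) =
    (LINT v|lborel. weight v / (1 + v) * (evol (\<epsilon> * (1 + v)) x - evol (T * (1 + v)) x))"
proof -
  let ?f = "\<lambda>\<tau> v. indicator {\<epsilon>..T} \<tau> * (weight v * devol (\<tau> * (1 + v)) x)"
  have "(LINT \<tau>|lborel. indicator {\<epsilon>..T} \<tau> * (\<tau> powr - a * (Gamma a * (LINT y|lborel. hgrad \<tau> (x - y) \<bullet> D y)))) =
     (LINT \<tau>|lborel. - (LINT v|lborel. ?f \<tau> v))"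
  proof (intro Bochner_Integration.integral_cong refl)
    fix \<tau>
    show "indicator {\<epsilon>..T} \<tau> * (\<tau> powr - a * (Gamma a * (LINT y|lborel. hgrad \<tau> (x - y) \<bullet> D y))) =
      - (LINT v|lborel. ?f \<tau> v)"
    proof (cases "\<tau> \<in> {\<epsilon>..T}")
      case True
      then have "0 < \<tau>" using \<epsilon> by simp
      from hgrad_D_integral_scaled[OF this, of x] True show ?thesis by simp
    qed simp
  qed
  also have "\<dots> = - (LINT \<tau>|lborel. LINT v|lborel. ?f \<tau> v)" by simp
  also have "(LINT \<tau>|lborel. LINT v|lborel. ?f \<tau> v) = (LINT v|lborel. LINT \<tau>|lborel. ?f \<tau> v)"
  \<comment> \<open>The bound of \<open>devol\<close> at time \<tau> (1 + v) carries 1 / (1 + v), so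
    integration in v leaves exactly \<open>beta_const\<close>.\<close>
  proof (rule fubini_dominated[where m = "\<lambda>\<tau>. indicator {\<epsilon>..T} \<tau> * (beta_const * (M * n / \<epsilon>))"])
    have "integrable lborel (indicator {\<epsilon>..T} :: real \<Rightarrow> real)"
      by (rule integrable_real_indicator) (use \<epsilon> in auto)
    then show "integrable lborel (\<lambda>\<tau>. indicator {\<epsilon>..T} \<tau> * (beta_const * (M * n / \<epsilon>)))"
      by (rule integrable_mult_left)
    fix \<tau>
    show "(\<integral>\<^sup>+v. ennreal (norm (?f \<tau> v)) \<partial>lborel) \<le> ennreal (indicator {\<epsilon>..T} \<tau> * (beta_const * (M * n / \<epsilon>)))"
    proof (cases "\<tau> \<in> {\<epsilon>..T}")
      case True
      have "(\<integral>\<^sup>+v. ennreal (norm (?f \<tau> v)) \<partial>lborel) \<le> (\<integral>\<^sup>+v. ennreal (weight v / (1 + v) * (M * n / \<epsilon>)) \<partial>lborel)"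
      proof (intro nn_integral_mono ennreal_leI)
        fix v :: real
        show "norm (?f \<tau> v) \<le> weight v / (1 + v) * (M * n / \<epsilon>)"
        proof (cases "0 < v")
          case v: True
          have "\<bar>devol (\<tau> * (1 + v)) x\<bar> \<le> M * n / (\<tau> * (1 + v))"
            using True v \<epsilon> by (intro devol_bound) auto
          also have "\<dots> \<le> M * n / (\<epsilon> * (1 + v))"
            using True v \<epsilon> M0 n by (intro divide_left_mono mult_right_mono) auto
          finally have "v powr (a - 1) * \<bar>devol (\<tau> * (1 + v)) x\<bar> \<le> v powr (a - 1) * (M * n / (\<epsilon> * (1 + v)))"
            by (rule mult_left_mono) simp
          then show ?thesis using True v by (simp add: abs_mult mult.commute)
        qed simp
      qed
      also have "\<dots> = ennreal (beta_const * (M * n / \<epsilon>))"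
      proof (subst nn_integral_eq_integral)
        show "AE v in lborel. 0 \<le> weight v / (1 + v) * (M * n / \<epsilon>)"
        proof (intro AE_I2)
          fix v show "0 \<le> weight v / (1 + v) * (M * n / \<epsilon>)"
            using M0 n \<epsilon> by (cases "0 < v") auto
        qed
      next
        show "integrable lborel (\<lambda>v. weight v / (1 + v) * (M * n / \<epsilon>))"
          by (rule integrable_mult_left[OF weight_integrable(2)])
        show "ennreal (LINT v|lborel. weight v / (1 + v) * (M * n / \<epsilon>)) = ennreal (beta_const * (M * n / \<epsilon>))"
          unfolding beta_const_def by (rule arg_cong[where f = ennreal], rule integral_mult_left_zero)
      qed
      finally show ?thesis using True by simp
    qed simp
  qed measurable
  also have "- \<dots> = (LINT v|lborel. - (LINT \<tau>|lborel. ?f \<tau> v))" by simp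
  also have "\<dots> = (LINT v|lborel. weight v / (1 + v) * (evol (\<epsilon> * (1 + v)) x - evol (T * (1 + v)) x))"
  proof (intro Bochner_Integration.integral_cong refl)
    fix v :: real
    show "- (LINT \<tau>|lborel. ?f \<tau> v) = weight v / (1 + v) * (evol (\<epsilon> * (1 + v)) x - evol (T * (1 + v)) x)"
    proof (cases "0 < v")
      case True
      have "(LINT \<tau>|lborel. ?f \<tau> v) = weight v * (LINT \<tau>|lborel. indicator {\<epsilon>..T} \<tau> * devol (\<tau> * (1 + v)) x)"
        by (subst integral_mult_right_zero[symmetric]) (simp add: mult_ac)
      then show ?thesis using True
        by (subst (asm) devol_integral[OF \<epsilon>]) (auto simp: field_simps)
    qed simp
  qed
  finally show ?thesis .
qed

lemma evol_measurable [measurable (raw)]: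
  assumes [measurable]: "f \<in> borel_measurable N" "g \<in> borel_measurable N"
  shows "(\<lambda>x. evol (f x) (g x)) \<in> borel_measurable N"
  unfolding evol_def by measurable

text \<open>In \<open>time_average_identity\<close> the evolution at \<epsilon> (1 + v) is replaced
  by u x and the one at T (1 + v) by its sup bound, which is largest at v = 0; both errors are then
  integrated against the weight.\<close>

lemma pointwise_estimate_cutoff:
  assumes \<epsilon>: "0 < \<epsilon>" "\<epsilon> \<le> T"
  shows "beta_const * \<bar>u x\<bar> \<le>
    \<bar>LINT \<tau>|lborel. indicator {\<epsilon>..T} \<tau> * (\<tau> powr - a * (Gamma a * (LINT y|lborel. hgrad \<tau> (x - y) \<bullet> D y)))\<bar>
    + beta_const * ((4 * pi * T) powr (- n / 2) * (LINT z|lborel. \<bar>u z\<bar>))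
    + L * (n + 1) * sqrt \<epsilon> * (LINT v|lborel. weight v / sqrt (1 + v))"
proof -
  let ?I = "LINT v|lborel. weight v / (1 + v) * (evol (\<epsilon> * (1 + v)) x - evol (T * (1 + v)) x)"
  let ?b = "(4 * pi * T) powr (- n / 2) * (LINT z|lborel. \<bar>u z\<bar>)"
  let ?d = "\<lambda>v. evol (\<epsilon> * (1 + v)) x - evol (T * (1 + v)) x"
  let ?e = "\<lambda>v. weight v / (1 + v) * ?b + weight v / sqrt (1 + v) * (L * (n + 1) * sqrt \<epsilon>)"
  have T: "0 < T" using \<epsilon> by simp
  have e: "integrable lborel ?e"
    using weight_integrable by (intro Bochner_Integration.integrable_add integrable_mult_left) auto
  have pw: "\<bar>weight v / (1 + v) * u x - weight v / (1 + v) * ?d v\<bar> \<le> ?e v" for v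
  proof (cases "0 < v")
    case v: True
    have "\<bar>evol (\<epsilon> * (1 + v)) x - u x\<bar> \<le> L * (n + 1) * sqrt (\<epsilon> * (1 + v))"
      using v \<epsilon> by (intro evol_approx) auto
    moreover have "\<bar>evol (T * (1 + v)) x\<bar> \<le> ?b"
    proof -
      have "\<bar>evol (T * (1 + v)) x\<bar> \<le> (4 * pi * (T * (1 + v))) powr (- n / 2) * (LINT z|lborel. \<bar>u z\<bar>)"
        using v T by (intro evol_bound) auto
      also have "\<dots> \<le> ?b"
        using v T n by (intro mult_right_mono powr_mono2') auto
      finally show ?thesis .
    qed
    ultimately have d: "\<bar>u x - ?d v\<bar> \<le> ?b + L * (n + 1) * sqrt (\<epsilon> * (1 + v))" by linarith
    have w: "0 \<le> weight v / (1 + v)" using v by simp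
    have "\<bar>weight v / (1 + v) * u x - weight v / (1 + v) * ?d v\<bar> = weight v / (1 + v) * \<bar>u x - ?d v\<bar>"
      using w by (simp only: right_diff_distrib[symmetric] abs_mult abs_of_nonneg)
    also have "\<dots> \<le> weight v / (1 + v) * (?b + L * (n + 1) * sqrt (\<epsilon> * (1 + v)))"
      by (rule mult_left_mono[OF d w])
    also have "\<dots> = ?e v"
    proof -
      have e0: "sqrt (1 + v) / (1 + v) = 1 / sqrt (1 + v)"
        using v sqrt_divide_self_eq[of "1 + v"] by (simp add: inverse_eq_divide)
      have "weight v / (1 + v) * sqrt (1 + v) = weight v * (sqrt (1 + v) / (1 + v))" by simp
      also have "\<dots> = weight v / sqrt (1 + v)" unfolding e0 by simp
      finally have e: "weight v / (1 + v) * sqrt (1 + v) = weight v / sqrt (1 + v)" .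
      have "w * (b + c * (d * e)) = w * b + (w * e) * (c * d)" for w b c d e :: real
        by (simp add: algebra_simps)
      from this[of "weight v / (1 + v)" ?b "L * (n + 1)" "sqrt \<epsilon>" "sqrt (1 + v)"]
      show ?thesis unfolding real_sqrt_mult e .
    qed
    finally show ?thesis .
  qed simp
  have wu: "integrable lborel (\<lambda>v. weight v / (1 + v) * u x)"
    using weight_integrable(2) by (rule integrable_mult_left)
  have diff: "integrable lborel (\<lambda>v. weight v / (1 + v) * u x - weight v / (1 + v) * ?d v)"
  proof (rule Bochner_Integration.integrable_bound[OF e])
    show "AE v in lborel. norm (weight v / (1 + v) * u x - weight v / (1 + v) * ?d v) \<le> norm (?e v)"
      unfolding real_norm_def by (intro AE_I2 order.trans[OF pw abs_ge_self])
  qed measurable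
  \<comment> \<open>Integrability of the \<open>?d\<close> term is read off from the dominated
    difference instead of being bounded on its own.\<close>
  from Bochner_Integration.integrable_diff[OF wu diff]
  have wd: "integrable lborel (\<lambda>v. weight v / (1 + v) * ?d v)" by simp
  have "beta_const * u x - ?I = (LINT v|lborel. weight v / (1 + v) * u x - weight v / (1 + v) * ?d v)"
    unfolding Bochner_Integration.integral_diff[OF wu wd] beta_const_def integral_mult_left_zero ..
  moreover have "\<bar>LINT v|lborel. weight v / (1 + v) * u x - weight v / (1 + v) * ?d v\<bar> \<le> integral\<^sup>L lborel ?e"
    by (rule integral_abs_bound[THEN order.trans], rule integral_mono[OF integrable_abs[OF diff] e pw])
  moreover have "integral\<^sup>L lborel ?e = beta_const * ?b + (LINT v|lborel. weight v / sqrt (1 + v)) * (L * (n + 1) * sqrt \<epsilon>)"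
    unfolding beta_const_def integral_mult_left_zero[symmetric]
    by (intro Bochner_Integration.integral_add integrable_mult_left weight_integrable)
  moreover have "beta_const * \<bar>u x\<bar> = \<bar>beta_const * u x\<bar>"
    using beta_const_pos by (simp add: abs_mult)
  moreover have "(LINT v|lborel. weight v / sqrt (1 + v)) * (L * (n + 1) * sqrt \<epsilon>) =
      L * (n + 1) * sqrt \<epsilon> * (LINT v|lborel. weight v / sqrt (1 + v))"
    by (rule mult.commute)
  ultimately show ?thesis unfolding time_average_identity[OF \<epsilon>] by linarith
qed

text \<open>Absolute values go inside both integrals, [\<epsilon>, T] is enlarged to (0, T], and
  Tonelli collects the time integral into \<open>hgrad_mean\<close>. The resulting bound is free of
  \<epsilon>.\<close>

lemma cutoff_term_bound:
  assumes \<epsilon>: "0 < \<epsilon>" "\<epsilon> \<le> T"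
  shows "ennreal \<bar>LINT \<tau>|lborel. indicator {\<epsilon>..T} \<tau> * (\<tau> powr - a * (Gamma a * (LINT y|lborel. hgrad \<tau> (x - y) \<bullet> D y)))\<bar>
    \<le> ennreal (Gamma a) * (\<integral>\<^sup>+y. hgrad_mean a T (x - y) * ennreal (norm (D y)) \<partial>lborel)"
proof -
  have G: "0 < Gamma a" using a by (intro Gamma_real_pos)
  let ?w = "\<lambda>\<tau>. ennreal (indicator {0<..T} \<tau> * \<tau> powr - a)"
  have "ennreal \<bar>LINT \<tau>|lborel. indicator {\<epsilon>..T} \<tau> * (\<tau> powr - a * (Gamma a * (LINT y|lborel. hgrad \<tau> (x - y) \<bullet> D y)))\<bar>
    \<le> (\<integral>\<^sup>+\<tau>. ennreal (norm (indicator {\<epsilon>..T} \<tau> * (\<tau> powr - a * (Gamma a * (LINT y|lborel. hgrad \<tau> (x - y) \<bullet> D y))))) \<partial>lborel)"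
    unfolding real_norm_def[symmetric] by (rule integral_norm_le_nn_integral)
  also have "\<dots> \<le> (\<integral>\<^sup>+\<tau>. ennreal (Gamma a) * (\<integral>\<^sup>+y. ?w \<tau> * ennreal (norm (hgrad \<tau> (x - y))) * ennreal (norm (D y)) \<partial>lborel) \<partial>lborel)"
  proof (intro nn_integral_mono)
    fix \<tau> :: real
    show "ennreal (norm (indicator {\<epsilon>..T} \<tau> * (\<tau> powr - a * (Gamma a * (LINT y|lborel. hgrad \<tau> (x - y) \<bullet> D y)))))
      \<le> ennreal (Gamma a) * (\<integral>\<^sup>+y. ?w \<tau> * ennreal (norm (hgrad \<tau> (x - y))) * ennreal (norm (D y)) \<partial>lborel)"
    proof (cases "\<tau> \<in> {\<epsilon>..T}")
      case True
      have "ennreal (norm (indicator {\<epsilon>..T} \<tau> * (\<tau> powr - a * (Gamma a * (LINT y|lborel. hgrad \<tau> (x - y) \<bullet> D y)))))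
        = ennreal (Gamma a * (\<tau> powr - a * norm (LINT y|lborel. hgrad \<tau> (x - y) \<bullet> D y)))"
        using True G by (simp add: abs_mult mult_ac)
      also have "\<dots> = ennreal (Gamma a) * (?w \<tau> * ennreal (norm (LINT y|lborel. hgrad \<tau> (x - y) \<bullet> D y)))"
        using True \<epsilon> by (subst ennreal_mult'[OF less_imp_le[OF G]], subst ennreal_mult'[OF powr_ge_zero]) simp
      also have "\<dots> \<le> ennreal (Gamma a) * (?w \<tau> * (\<integral>\<^sup>+y. ennreal (norm (hgrad \<tau> (x - y) \<bullet> D y)) \<partial>lborel))"
        by (intro mult_left_mono integral_norm_le_nn_integral) auto
      also have "\<dots> \<le> ennreal (Gamma a) * (?w \<tau> * (\<integral>\<^sup>+y. ennreal (norm (hgrad \<tau> (x - y))) * ennreal (norm (D y)) \<partial>lborel))"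
      proof (intro mult_left_mono nn_integral_mono)
        fix y
        show "ennreal (norm (hgrad \<tau> (x - y) \<bullet> D y)) \<le> ennreal (norm (hgrad \<tau> (x - y))) * ennreal (norm (D y))"
          unfolding ennreal_mult'[OF norm_ge_zero, symmetric] real_norm_def
          by (intro ennreal_leI Cauchy_Schwarz_ineq2)
      qed auto
      also have "\<dots> = ennreal (Gamma a) * (\<integral>\<^sup>+y. ?w \<tau> * ennreal (norm (hgrad \<tau> (x - y))) * ennreal (norm (D y)) \<partial>lborel)"
        by (subst nn_integral_cmult[symmetric]) (auto simp: mult.assoc)
      finally show ?thesis .
    qed simp
  qed
  also have "\<dots> = ennreal (Gamma a) * (\<integral>\<^sup>+\<tau>. \<integral>\<^sup>+y. ?w \<tau> * ennreal (norm (hgrad \<tau> (x - y))) * ennreal (norm (D y)) \<partial>lborel \<partial>lborel)"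
    by (rule nn_integral_cmult) measurable
  also have "(\<integral>\<^sup>+\<tau>. \<integral>\<^sup>+y. ?w \<tau> * ennreal (norm (hgrad \<tau> (x - y))) * ennreal (norm (D y)) \<partial>lborel \<partial>lborel) =
     (\<integral>\<^sup>+y. \<integral>\<^sup>+\<tau>. ?w \<tau> * ennreal (norm (hgrad \<tau> (x - y))) * ennreal (norm (D y)) \<partial>lborel \<partial>lborel)"
    by (rule lborel_pair.Fubini') measurable
  also have "\<dots> = (\<integral>\<^sup>+y. hgrad_mean a T (x - y) * ennreal (norm (D y)) \<partial>lborel)"
    unfolding hgrad_mean_def by (subst nn_integral_multc) auto
  finally show ?thesis .
qed

lemma hgrad_mean_D_finite:
  assumes "0 < T"
  shows "(\<integral>\<^sup>+y. hgrad_mean a T (x - y) * ennreal (norm (D y)) \<partial>lborel) < \<infinity>"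
proof -
  obtain K where K: "\<And>y. norm (D y) \<le> K" using D_bounded by auto
  have "(\<integral>\<^sup>+y. hgrad_mean a T (x - y) * ennreal (norm (D y)) \<partial>lborel)
      \<le> (\<integral>\<^sup>+y. hgrad_mean a T (x - y) * ennreal K \<partial>lborel)"
    by (intro nn_integral_mono mult_left_mono ennreal_leI K) auto
  also have "\<dots> = (\<integral>\<^sup>+w. hgrad_mean a T (w::'a) \<partial>lborel) * ennreal K"
    by (subst nn_integral_multc) (auto intro!: arg_cong2[where f = "(*)"] nn_integral_lborel_diff)
  also have "\<dots> \<le> ennreal ((real DIM('a) + 1) / s * T powr (s / 2)) * ennreal K"
    using nn_integral_hgrad_mean[OF s assms, where 'a='a] unfolding a_def by (rule mult_right_mono) simp
  also have "\<dots> < \<infinity>" by (simp add: ennreal_mult_less_top)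
  finally show ?thesis .
qed

text \<open>Only the term with sqrt \<epsilon> depends on the cutoff, so \<epsilon> tends to 0 in
  the inequality itself, without any limit of the truncated integrals. Division by
  \<open>beta_const\<close> isolates |u x|.\<close>

lemma pointwise_estimate:
  assumes T: "0 < T"
  shows "\<bar>u x\<bar> \<le> 2 * Gamma (a + 1) * enn2real (\<integral>\<^sup>+y. hgrad_mean a T (x - y) * ennreal (norm (D y)) \<partial>lborel)
    + (4 * pi * T) powr (- n / 2) * (LINT z|lborel. \<bar>u z\<bar>)"
proof -
  define R where "R = enn2real (\<integral>\<^sup>+y. hgrad_mean a T (x - y) * ennreal (norm (D y)) \<partial>lborel)"
  let ?b = "(4 * pi * T) powr (- n / 2) * (LINT z|lborel. \<bar>u z\<bar>)"
  let ?c = "L * (n + 1) * (LINT v|lborel. weight v / sqrt (1 + v))"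
  have G: "0 < Gamma a" using a by (intro Gamma_real_pos)
  have R: "(\<integral>\<^sup>+y. hgrad_mean a T (x - y) * ennreal (norm (D y)) \<partial>lborel) = ennreal R" "0 \<le> R"
    unfolding R_def using hgrad_mean_D_finite[OF T, of x] by auto
  have eps: "beta_const * \<bar>u x\<bar> \<le> Gamma a * R + beta_const * ?b + ?c * sqrt \<epsilon>" if "0 < \<epsilon>" "\<epsilon> < T" for \<epsilon>
  proof -
    have "\<bar>LINT \<tau>|lborel. indicator {\<epsilon>..T} \<tau> * (\<tau> powr - a * (Gamma a * (LINT y|lborel. hgrad \<tau> (x - y) \<bullet> D y)))\<bar> \<le> Gamma a * R"
      using cutoff_term_bound[of \<epsilon> T x] that G R
      by (simp add: ennreal_mult'[symmetric] ennreal_le_iff)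
    then show ?thesis using pointwise_estimate_cutoff[of \<epsilon> T x] that by (simp add: mult_ac)
  qed
  have "((\<lambda>\<epsilon>. Gamma a * R + beta_const * ?b + ?c * sqrt \<epsilon>) \<longlongrightarrow> Gamma a * R + beta_const * ?b + ?c * sqrt 0) (at_right 0)"
    by (intro tendsto_intros)
  moreover have "\<forall>\<^sub>F \<epsilon> in at_right 0. beta_const * \<bar>u x\<bar> \<le> Gamma a * R + beta_const * ?b + ?c * sqrt \<epsilon>"
    using eps T by (intro eventually_at_rightI[of 0 T]) auto
  ultimately have "beta_const * \<bar>u x\<bar> \<le> Gamma a * R + beta_const * ?b + ?c * sqrt 0"
    by (intro tendsto_lowerbound[of _ _ "at_right 0"]) auto
  then have main: "\<bar>u x\<bar> \<le> Gamma a / beta_const * R + ?b"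
    using beta_const_pos by (simp add: field_simps)
  \<comment> \<open>\<open>Gamma a\<close> has a pole at a = 0; divided by 1 / (2 a) it becomes 2 a
    Gamma a = 2 Gamma (a + 1), which stays bounded as s tends to 1.\<close>
  have "Gamma a / beta_const \<le> Gamma a / (1 / (2 * a))"
    using beta_const_ge beta_const_pos a G by (intro divide_left_mono) auto
  also have "\<dots> = 2 * Gamma (a + 1)"
  proof -
    have "a \<notin> \<int>\<^sub>\<le>\<^sub>0" using a by (auto elim!: nonpos_Ints_cases)
    then show ?thesis by (simp add: Gamma_plus1)
  qed
  finally have "Gamma a / beta_const * R \<le> 2 * Gamma (a + 1) * R"
    using R(2) by (rule mult_right_mono)
  then show ?thesis using main unfolding R_def by linarith
qed

end

section \<open>Lebesgue spaces\<close>

text \<open>Convexity: the graph of x powr p lies above its tangent at m, here with the negative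
  term moved across. It is Young's product inequality with conjugate exponent p / (p - 1).\<close>

lemma powr_tangent:
  fixes p m x :: real
  assumes p: "1 < p" and "0 \<le> m" "0 \<le> x"
  shows "p * m powr (p - 1) * x \<le> x powr p + (p - 1) * m powr p"
proof -
  define q where "q = p / (p - 1)"
  have q: "1 < q" "1 / p + 1 / q = 1" "(p - 1) * q = p"
    using p by (auto simp: q_def field_simps)
  have "x * m powr (p - 1) \<le> x powr p / p + (m powr (p - 1)) powr q / q"
    using assms q by (intro Youngs_inequality) auto
  also have "(m powr (p - 1)) powr q = m powr p" by (simp add: powr_powr q)
  finally have "p * (x * m powr (p - 1)) \<le> p * (x powr p / p + m powr p / q)"
    using p by (intro mult_left_mono) auto
  also have "\<dots> = x powr p + (p - 1) * m powr p"
    using p by (simp add: q_def field_simps)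
  finally show ?thesis by (simp add: mult_ac)
qed

text \<open>Jensen's inequality for the measure with density \<open>K\<close>, by the tangent at m =
  R / \<kappa>. A total mass below \<kappa> suffices because it multiplies the nonnegative number (p
  - 1) m^p. With \<open>K\<close> a convolution kernel this yields Young's inequality, with
  \<open>K\<close> an indicator Hoelder's.\<close>

lemma weighted_power_mean:
  fixes R \<kappa> p :: real
  assumes p: "1 < p" and \<kappa>: "0 < \<kappa>" and R: "0 \<le> R"
    and K [measurable]: "K \<in> borel_measurable N" and f [measurable]: "f \<in> borel_measurable N"
    and f0: "\<And>x. 0 \<le> f x"
    and mass: "(\<integral>\<^sup>+x. K x \<partial>N) \<le> ennreal \<kappa>"
    and mean: "(\<integral>\<^sup>+x. K x * ennreal (f x) \<partial>N) = ennreal R"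
  shows "ennreal (R powr p) \<le> ennreal (\<kappa> powr (p - 1)) * (\<integral>\<^sup>+x. K x * ennreal (f x powr p) \<partial>N)"
proof (cases "(\<integral>\<^sup>+x. K x * ennreal (f x powr p) \<partial>N) = \<infinity>")
  case True
  then show ?thesis using \<kappa> by (simp add: ennreal_mult_top)
next
  case False
  define J where "J = enn2real (\<integral>\<^sup>+x. K x * ennreal (f x powr p) \<partial>N)"
  have J: "(\<integral>\<^sup>+x. K x * ennreal (f x powr p) \<partial>N) = ennreal J" "0 \<le> J"
    using False by (auto simp: J_def top.not_eq_extremum)
  define m where "m = R / \<kappa>"
  have m: "0 \<le> m" using R \<kappa> by (simp add: m_def)
  have "ennreal (p * m powr (p - 1) * R) = (\<integral>\<^sup>+x. ennreal (p * m powr (p - 1)) * (K x * ennreal (f x)) \<partial>N)"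
    using p R by (subst nn_integral_cmult) (auto simp: mean ennreal_mult')
  also have "\<dots> \<le> (\<integral>\<^sup>+x. K x * ennreal (f x powr p) + K x * ennreal ((p - 1) * m powr p) \<partial>N)"
  proof (intro nn_integral_mono)
    fix x
    have "ennreal (p * m powr (p - 1)) * ennreal (f x) \<le> ennreal (f x powr p) + ennreal ((p - 1) * m powr p)"
      using powr_tangent[OF p m f0[of x]] p
      by (subst ennreal_mult'[symmetric]) (auto simp flip: ennreal_plus intro!: ennreal_leI)
    from mult_left_mono[OF this, of "K x"]
    show "ennreal (p * m powr (p - 1)) * (K x * ennreal (f x)) \<le> K x * ennreal (f x powr p) + K x * ennreal ((p - 1) * m powr p)"
      by (simp add: distrib_left mult_ac)
  qed
  also have "\<dots> = ennreal J + (\<integral>\<^sup>+x. K x \<partial>N) * ennreal ((p - 1) * m powr p)"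
    by (subst nn_integral_add) (auto simp: J nn_integral_multc)
  also have "\<dots> \<le> ennreal J + ennreal \<kappa> * ennreal ((p - 1) * m powr p)"
    by (intro add_left_mono mult_right_mono mass) simp
  also have "\<dots> = ennreal (J + \<kappa> * ((p - 1) * m powr p))"
    using \<kappa> p J by (simp add: ennreal_mult' ennreal_plus)
  finally have "p * m powr (p - 1) * R \<le> J + \<kappa> * ((p - 1) * m powr p)"
    using J p \<kappa> by (subst (asm) ennreal_le_iff) auto
  moreover have "m powr (p - 1) * R = \<kappa> * m powr p"
  proof -
    have "R = \<kappa> * m" using \<kappa> by (simp add: m_def)
    moreover have "m * m powr (p - 1) = m powr p" using m by (simp add: powr_mult_base)
    ultimately show ?thesis by (metis mult.assoc mult.commute)
  qed
  then have "p * m powr (p - 1) * R = p * (\<kappa> * m powr p)" by simp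
  moreover have "\<kappa> * ((p - 1) * m powr p) = p * (\<kappa> * m powr p) - \<kappa> * m powr p"
    by (simp add: algebra_simps)
  ultimately have "\<kappa> * m powr p \<le> J" by linarith
  then have "\<kappa> powr (p - 1) * (\<kappa> * m powr p) \<le> \<kappa> powr (p - 1) * J"
    by (rule mult_left_mono) simp
  moreover have "\<kappa> powr (p - 1) * (\<kappa> * m powr p) = R powr p"
  proof -
    have "\<kappa> * \<kappa> powr (p - 1) = \<kappa> powr p" using \<kappa> by (simp add: powr_mult_base)
    then have "\<kappa> powr (p - 1) * (\<kappa> * m powr p) = \<kappa> powr p * m powr p" by (metis mult.assoc mult.commute)
    also have "\<dots> = (\<kappa> * m) powr p" by (simp add: powr_mult)
    finally show ?thesis using \<kappa> by (simp add: m_def)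
  qed
  ultimately show ?thesis
    unfolding J by (simp add: ennreal_mult'[symmetric] ennreal_leI)
qed

section \<open>The norm of L^p and Minkowski's inequality\<close>

lemma Lp_norm_nonneg: "0 \<le> Lp_norm N p f"
  by (simp add: Lp_norm_def)

lemma Lp_norm_powr: "0 < p \<Longrightarrow> Lp_norm N p f powr p = (LINT x|N. norm (f x) powr p)"
  by (simp add: Lp_norm_def powr_powr integral_nonneg_AE)

lemma Lp_norm_le_iff:
  assumes "0 < p" "0 \<le> c"
  shows "Lp_norm N p f \<le> c \<longleftrightarrow> (LINT x|N. norm (f x) powr p) \<le> c powr p"
proof -
  have "Lp_norm N p f \<le> c \<longleftrightarrow> Lp_norm N p f powr p \<le> c powr p"
    using assms Lp_norm_nonneg[of N p f] by (meson less_imp_le not_le powr_less_mono2 powr_mono2)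
  then show ?thesis using assms by (simp add: Lp_norm_powr)
qed

text \<open>Optimised over \<open>\<theta>\<close>, this yields Minkowski's inequality.\<close>

lemma powr_add_le:
  fixes b c p \<theta> :: real
  assumes p: "1 < p" and nn: "0 \<le> b" "0 \<le> c" and \<theta>: "0 < \<theta>" "\<theta> < 1"
  shows "(b + c) powr p \<le> (1 - \<theta>) powr (1 - p) * b powr p + \<theta> powr (1 - p) * c powr p"
proof -
  let ?m = "b + c"
  have *: "p * ?m powr (p - 1) * d \<le> t powr (1 - p) * d powr p + t * ((p - 1) * ?m powr p)"
    if "0 \<le> d" "0 < t" for d t
  proof -
    have "t * (p * ?m powr (p - 1) * (d / t)) \<le> t * ((d / t) powr p + (p - 1) * ?m powr p)"
      using that nn p by (intro mult_left_mono powr_tangent) auto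
    moreover have "t * (d / t) powr p = t powr (1 - p) * d powr p"
      using that by (simp add: powr_divide powr_diff)
    ultimately show ?thesis using that by (simp add: distrib_left)
  qed
  have "p * ?m powr (p - 1) * b + p * ?m powr (p - 1) * c \<le>
     ((1 - \<theta>) powr (1 - p) * b powr p + (1 - \<theta>) * ((p - 1) * ?m powr p)) +
     (\<theta> powr (1 - p) * c powr p + \<theta> * ((p - 1) * ?m powr p))"
    using \<theta> nn by (intro add_mono *) auto
  moreover have "p * ?m powr (p - 1) * b + p * ?m powr (p - 1) * c = p * ?m powr p"
  proof -
    have "?m * ?m powr (p - 1) = ?m powr p" using nn by (simp add: powr_mult_base)
    then show ?thesis by (metis distrib_left mult.assoc mult.commute)
  qed
  ultimately show ?thesis by (simp add: algebra_simps)
qed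

text \<open>Membership comes from \<open>powr_add_le\<close> at \<theta> = 1/2; the sharp constant
  needs \<theta> adapted to the ratio of the two norms.\<close>

lemma Lp_space_add:
  assumes p: "1 < p" and f: "f \<in> Lp_space N p" and g: "g \<in> Lp_space N p"
  shows "(\<lambda>x. f x + g x) \<in> Lp_space N p"
    and "Lp_norm N p (\<lambda>x. f x + g x) \<le> Lp_norm N p f + Lp_norm N p g"
proof -
  have [measurable]: "f \<in> borel_measurable N" "g \<in> borel_measurable N"
    and fi: "integrable N (\<lambda>x. norm (f x) powr p)" and gi: "integrable N (\<lambda>x. norm (g x) powr p)"
    using f g by (auto simp: Lp_space_def)
  let ?h = "\<lambda>\<theta> x. (1 - \<theta>) powr (1 - p) * norm (f x) powr p + \<theta> powr (1 - p) * norm (g x) powr p"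
  have h: "integrable N (?h \<theta>)" for \<theta> using fi gi by simp
  have le: "norm (f x + g x) powr p \<le> ?h \<theta> x" if "0 < \<theta>" "\<theta> < 1" for \<theta> x
    using powr_mono2[of p "norm (f x + g x)" "norm (f x) + norm (g x)"] norm_triangle_ineq[of "f x" "g x"] p
      powr_add_le[OF p norm_ge_zero norm_ge_zero that, of "f x" "g x"] by auto
  have int: "integrable N (\<lambda>x. norm (f x + g x) powr p)"
    by (rule Bochner_Integration.integrable_bound[OF h[of "1/2"]])
      (use le[of "1/2"] in \<open>auto intro!: AE_I2 intro: order.trans[OF _ abs_ge_self]\<close>)
  then show "(\<lambda>x. f x + g x) \<in> Lp_space N p" by (simp add: Lp_space_def)
  show "Lp_norm N p (\<lambda>x. f x + g x) \<le> Lp_norm N p f + Lp_norm N p g"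
  proof (rule field_le_epsilon)
    fix e :: real assume e: "0 < e"
    \<comment> \<open>Adding e / 2 keeps F and G positive, so that \<theta> lies strictly between 0
      and 1 even when a norm vanishes.\<close>
    define F where "F = Lp_norm N p f + e / 2"
    define G where "G = Lp_norm N p g + e / 2"
    have F: "0 < F" "Lp_norm N p f \<le> F" and G: "0 < G" "Lp_norm N p g \<le> G"
      using e Lp_norm_nonneg[of N p f] Lp_norm_nonneg[of N p g] by (auto simp: F_def G_def)
    define \<theta> where "\<theta> = G / (F + G)"
    have \<theta>: "0 < \<theta>" "\<theta> < 1" "1 - \<theta> = F / (F + G)" using F G by (auto simp: \<theta>_def field_simps)
    have "(LINT x|N. norm (f x + g x) powr p) \<le> (LINT x|N. ?h \<theta> x)"
      using \<theta> by (intro integral_mono int h le)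
    also have "\<dots> = (1 - \<theta>) powr (1 - p) * (LINT x|N. norm (f x) powr p) + \<theta> powr (1 - p) * (LINT x|N. norm (g x) powr p)"
      using fi gi by simp
    also have "\<dots> \<le> (1 - \<theta>) powr (1 - p) * F powr p + \<theta> powr (1 - p) * G powr p"
      using F G p by (intro add_mono mult_left_mono) (auto simp: Lp_norm_le_iff[symmetric])
    also have "\<dots> = (F + G) powr p"
    proof -
      have "(H / (F + G)) powr (1 - p) * H powr p = (F + G) powr (p - 1) * H" if "0 < H" for H
      proof -
        have "(F + G) powr (1 - p) * (F + G) powr (p - 1) = 1" "H powr (1 - p) * H powr p = H"
          using F G that by (simp_all add: powr_add[symmetric])
        then show ?thesis using F G that by (simp add: powr_divide field_simps)
      qed
      then have "(1 - \<theta>) powr (1 - p) * F powr p + \<theta> powr (1 - p) * G powr p = (F + G) * (F + G) powr (p - 1)"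
        unfolding \<theta>(3) unfolding \<theta>_def using F G by (simp add: algebra_simps)
      also have "\<dots> = (F + G) powr p" using F G by (simp add: powr_mult_base)
      finally show ?thesis .
    qed
    finally have "Lp_norm N p (\<lambda>x. f x + g x) \<le> F + G"
      using F G p by (subst Lp_norm_le_iff) auto
    then show "Lp_norm N p (\<lambda>x. f x + g x) \<le> Lp_norm N p f + Lp_norm N p g + e"
      by (simp add: F_def G_def)
  qed
qed

lemma Lp_norm_cmult:
  fixes f :: "'b \<Rightarrow> real"
  assumes "1 < p" "0 \<le> c"
  shows "Lp_norm N p (\<lambda>x. c * f x) = c * Lp_norm N p f"
  using assms by (simp add: Lp_norm_def abs_mult powr_mult powr_powr)

lemma Lp_space_cmult:
  fixes f :: "'b \<Rightarrow> real"
  shows "f \<in> Lp_space N p \<Longrightarrow> (\<lambda>x. c * f x) \<in> Lp_space N p"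
  by (auto simp: Lp_space_def abs_mult powr_mult)

section \<open>Young's inequality for convolutions\<close>

text \<open>The Sobolev spaces are stated over the completed measure, while Tonelli and convolutions
  are carried out on \<open>lborel\<close>; Borel functions pass between the two.\<close>

lemma Lp_lebesgue_eq_lborel:
  assumes [measurable]: "f \<in> borel_measurable borel"
  shows "Lp_norm lebesgue p f = Lp_norm lborel p f" "f \<in> Lp_space lebesgue p \<longleftrightarrow> f \<in> Lp_space lborel p"
  by (auto simp: Lp_norm_def Lp_space_def integral_completion integrable_completion measurable_completion)

text \<open>Jensen at each x, where the kernel has mass at most \<kappa>, then Tonelli; the constant
  is the same for all p. Pointwise finiteness is assumed because \<open>enn2real\<close> sends an
  infinite value to 0, which would break the equality that Jensen is applied to.\<close>

lemma Lp_norm_convolution: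
  fixes K :: "'a::euclidean_space \<Rightarrow> ennreal" and g :: "'a \<Rightarrow> 'b::euclidean_space"
  assumes p: "1 < p" and \<kappa>: "0 < \<kappa>" and K [measurable]: "K \<in> borel_measurable borel"
    and mass: "(\<integral>\<^sup>+y. K y \<partial>lborel) \<le> ennreal \<kappa>"
    and g: "g \<in> Lp_space lborel p"
    and finite: "\<And>x. (\<integral>\<^sup>+y. K (x - y) * ennreal (norm (g y)) \<partial>lborel) < \<infinity>"
  defines "R \<equiv> \<lambda>x. enn2real (\<integral>\<^sup>+y. K (x - y) * ennreal (norm (g y)) \<partial>lborel)"
  shows "R \<in> Lp_space lborel p" and "Lp_norm lborel p R \<le> \<kappa> * Lp_norm lborel p g"
proof -
  have [measurable]: "g \<in> borel_measurable borel" and gi: "integrable lborel (\<lambda>x. norm (g x) powr p)"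
    using g by (auto simp: Lp_space_def)
  have Rm [measurable]: "R \<in> borel_measurable borel" unfolding R_def by measurable
  have "(\<integral>\<^sup>+x. ennreal (R x powr p) \<partial>lborel) \<le>
     (\<integral>\<^sup>+x. ennreal (\<kappa> powr (p - 1)) * (\<integral>\<^sup>+y. K (x - y) * ennreal (norm (g y) powr p) \<partial>lborel) \<partial>lborel)"
  proof (intro nn_integral_mono weighted_power_mean p \<kappa>)
    fix x
    show "(\<integral>\<^sup>+y. K (x - y) \<partial>lborel) \<le> ennreal \<kappa>"
      using mass nn_integral_lborel_diff[OF K, of x] by simp
    show "(\<integral>\<^sup>+y. K (x - y) * ennreal (norm (g y)) \<partial>lborel) = ennreal (R x)"
      using finite[of x] by (simp add: R_def)
  qed (auto simp: R_def)
  also have "\<dots> = ennreal (\<kappa> powr (p - 1)) * (\<integral>\<^sup>+x. \<integral>\<^sup>+y. K (x - y) * ennreal (norm (g y) powr p) \<partial>lborel \<partial>lborel)"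
    by (rule nn_integral_cmult) measurable
  also have "(\<integral>\<^sup>+x. \<integral>\<^sup>+y. K (x - y) * ennreal (norm (g y) powr p) \<partial>lborel \<partial>lborel) =
      (\<integral>\<^sup>+y. \<integral>\<^sup>+x. K (x - y) * ennreal (norm (g y) powr p) \<partial>lborel \<partial>lborel)"
    by (rule lborel_pair.Fubini') measurable
  also have "\<dots> = (\<integral>\<^sup>+y. (\<integral>\<^sup>+x. K x \<partial>lborel) * ennreal (norm (g y) powr p) \<partial>lborel)"
  proof (intro nn_integral_cong)
    fix y
    show "(\<integral>\<^sup>+x. K (x - y) * ennreal (norm (g y) powr p) \<partial>lborel) = (\<integral>\<^sup>+x. K x \<partial>lborel) * ennreal (norm (g y) powr p)"
      using nn_integral_lborel_add[OF K, of "- y"] by (subst nn_integral_multc) auto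
  qed
  also have "\<dots> = (\<integral>\<^sup>+x. K x \<partial>lborel) * (\<integral>\<^sup>+y. ennreal (norm (g y) powr p) \<partial>lborel)"
    by (rule nn_integral_cmult) measurable
  also have "(\<integral>\<^sup>+y. ennreal (norm (g y) powr p) \<partial>lborel) = ennreal (Lp_norm lborel p g powr p)"
    using p by (subst nn_integral_eq_integral[OF gi]) (auto simp: Lp_norm_powr)
  also have "ennreal (\<kappa> powr (p - 1)) * ((\<integral>\<^sup>+x. K x \<partial>lborel) * ennreal (Lp_norm lborel p g powr p))
     \<le> ennreal (\<kappa> powr (p - 1)) * (ennreal \<kappa> * ennreal (Lp_norm lborel p g powr p))"
    by (intro mult_left_mono mult_right_mono mass) auto
  also have "\<dots> = ennreal (\<kappa> powr (p - 1) * (\<kappa> * Lp_norm lborel p g powr p))"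
    using \<kappa> by (simp add: ennreal_mult')
  also have "\<kappa> powr (p - 1) * (\<kappa> * Lp_norm lborel p g powr p) = (\<kappa> * Lp_norm lborel p g) powr p"
  proof -
    have "\<kappa> * \<kappa> powr (p - 1) = \<kappa> powr p" using \<kappa> by (simp add: powr_mult_base)
    then show ?thesis unfolding powr_mult by (metis mult.assoc mult.commute)
  qed
  finally have *: "(\<integral>\<^sup>+x. ennreal (R x powr p) \<partial>lborel) \<le> ennreal ((\<kappa> * Lp_norm lborel p g) powr p)" .
  have R0: "0 \<le> R x" for x by (simp add: R_def)
  have Ri: "integrable lborel (\<lambda>x. R x powr p)"
    using * by (intro integrableI_bounded) (auto intro: le_less_trans)
  then show "R \<in> Lp_space lborel p" using R0 by (simp add: Lp_space_def)
  have "(LINT x|lborel. norm (R x) powr p) \<le> (\<kappa> * Lp_norm lborel p g) powr p"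
    using * R0 by (subst (asm) nn_integral_eq_integral[OF Ri]) auto
  then show "Lp_norm lborel p R \<le> \<kappa> * Lp_norm lborel p g"
    using p \<kappa> Lp_norm_nonneg[of lborel p g] by (subst Lp_norm_le_iff) auto
qed

section \<open>The Poincare inequality\<close>

lemma Cc_infinity_vanishes: "v \<in> Cc_infinity \<Omega> \<Longrightarrow> x \<notin> \<Omega> \<Longrightarrow> v x = 0"
  using closure_subset[of "{x. v x \<noteq> 0}"] by (auto simp: Cc_infinity_def)

text \<open>Compact support bounds v and its partial derivatives, and the mean value theorem turns
  the latter bounds into a Lipschitz constant.\<close>

lemma Cc_infinity_heat_test_function:
  fixes v :: "'a::euclidean_space \<Rightarrow> real"
  assumes v: "v \<in> Cc_infinity \<Omega>" and s: "0 < s" "s < 1"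
  shows "\<exists>M L. heat_test_function v M L s"
proof -
  define S where "S = closure {x. v x \<noteq> 0}"
  have S: "compact S" and out: "\<And>x. x \<notin> S \<Longrightarrow> v x = 0"
    using v closure_subset[of "{x. v x \<noteq> 0}"] by (auto simp: Cc_infinity_def S_def)
  have "C_k (Suc 0) v" using v by (simp add: Cc_infinity_def)
  then have diff: "\<And>x. v differentiable (at x)"
    and cont': "\<And>b. b \<in> Basis \<Longrightarrow> continuous_on UNIV (\<lambda>x. frechet_derivative v (at x) b)"
    by auto
  have cont: "continuous_on UNIV v"
    using diff by (simp add: continuous_on_eq_continuous_at differentiable_imp_continuous_within)
  have bnd: "\<exists>B. \<forall>x. \<bar>f x\<bar> \<le> B" if "continuous_on UNIV f" "\<And>x. x \<notin> S \<Longrightarrow> f x = 0" for f :: "'a \<Rightarrow> real"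
  proof -
    have "compact (f ` S)"
      using that(1) S by (intro compact_continuous_image) (auto intro: continuous_on_subset)
    then have "bounded (f ` S)" by (rule compact_imp_bounded)
    then obtain B where B: "\<forall>y\<in>f ` S. norm y \<le> B" unfolding bounded_iff by blast
    have "\<bar>f x\<bar> \<le> max B 0" for x
    proof (cases "x \<in> S")
      case True
      then have "norm (f x) \<le> B" using B by blast
      then show ?thesis by simp
    qed (simp add: that(2))
    then show ?thesis by blast
  qed
  obtain M where M: "\<And>x. \<bar>v x\<bar> \<le> M" using bnd[OF cont out] by blast
  have der: "(v has_derivative frechet_derivative v (at x)) (at x)" for x
    using diff by (simp add: frechet_derivative_works)
  have "\<exists>B. \<forall>x. \<bar>frechet_derivative v (at x) b\<bar> \<le> B" if "b \<in> Basis" for b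
  proof (rule bnd[OF cont'[OF that]])
    fix x assume x: "x \<notin> S"
    have "open (- S)" using S by (simp add: compact_imp_closed open_Compl)
    then have "(v has_derivative (\<lambda>_. 0)) (at x)"
    proof (rule has_derivative_transform_within_open[OF has_derivative_const])
      show "x \<in> - S" using x by simp
      show "0 = v y" if "y \<in> - S" for y using out[of y] that by simp
    qed
    then have "frechet_derivative v (at x) = (\<lambda>_. 0)" by (rule frechet_derivative_at[symmetric])
    then show "frechet_derivative v (at x) b = 0" by simp
  qed
  then have "\<forall>b\<in>Basis. \<exists>B. \<forall>x. \<bar>frechet_derivative v (at x) b\<bar> \<le> B" by blast
  from bchoice[OF this] obtain B where B: "\<And>b x. b \<in> Basis \<Longrightarrow> \<bar>frechet_derivative v (at x) b\<bar> \<le> B b"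
    by blast
  \<comment> \<open>Each coordinate of h is at most |h|, so the sum of the bounds of the partial
    derivatives controls the operator norm.\<close>
  define L where "L = (\<Sum>b\<in>(Basis::'a set). B b)"
  have B0: "0 \<le> B b" if "b \<in> Basis" for b using B[OF that, of 0] by linarith
  have L0: "0 \<le> L" unfolding L_def by (rule sum_nonneg[OF B0])
  have on: "onorm (frechet_derivative v (at x)) \<le> L" for x
  proof (rule onorm_le)
    fix h
    have lin: "linear (frechet_derivative v (at x))" using der has_derivative_linear by blast
    have "frechet_derivative v (at x) (\<Sum>b\<in>Basis. (h \<bullet> b) *\<^sub>R b) = (\<Sum>b\<in>Basis. (h \<bullet> b) * frechet_derivative v (at x) b)"
      by (simp only: linear_sum[OF lin] linear_cmul[OF lin] real_scaleR_def)
    moreover have "\<bar>\<Sum>b\<in>Basis. (h \<bullet> b) * frechet_derivative v (at x) b\<bar> \<le> (\<Sum>b\<in>Basis. norm h * B b)"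
    proof (rule sum_abs[THEN order.trans], rule sum_mono)
      fix b :: 'a assume b: "b \<in> Basis"
      show "\<bar>(h \<bullet> b) * frechet_derivative v (at x) b\<bar> \<le> norm h * B b"
        unfolding abs_mult using b B Basis_le_norm by (intro mult_mono) auto
    qed
    ultimately show "norm (frechet_derivative v (at x) h) \<le> L * norm h"
      unfolding euclidean_representation L_def real_norm_def by (simp add: sum_distrib_left mult.commute)
  qed
  have lip: "\<bar>v x - v y\<bar> \<le> L * norm (x - y)" for x y
    using differentiable_bound[of UNIV v "\<lambda>x. frechet_derivative v (at x)" L x y] der on by simp
  have "integrable lborel (\<lambda>x. indicator S x *\<^sub>R v x)"
    using S cont by (intro borel_integrable_compact) (auto intro: continuous_on_subset)
  moreover have "indicator S x *\<^sub>R v x = v x" for x using out by (cases "x \<in> S") auto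
  ultimately have int: "integrable lborel v" by (simp only:)
  have "heat_test_function v M L s"
    by unfold_locales (use cont M L0 lip int s in \<open>auto intro: borel_measurable_continuous_onI\<close>)
  then show ?thesis by blast
qed

text \<open>Hoelder's inequality on \<Omega>, from \<open>weighted_power_mean\<close> with the
  indicator of \<Omega> as weight.\<close>

lemma L1_norm_le_Lp_norm:
  fixes u :: "'a::euclidean_space \<Rightarrow> real"
  assumes p: "1 < p" and u: "u \<in> Lp_space lborel p" and int: "integrable lborel u"
    and \<Omega> [measurable]: "\<Omega> \<in> sets borel" and V: "emeasure lborel \<Omega> \<le> ennreal V" "0 < V"
    and out: "\<And>x. x \<notin> \<Omega> \<Longrightarrow> u x = 0"
  shows "(LINT x|lborel. \<bar>u x\<bar>) \<le> V powr (1 - 1 / p) * Lp_norm lborel p u"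
proof -
  have [measurable]: "u \<in> borel_measurable borel" and ui: "integrable lborel (\<lambda>x. norm (u x) powr p)"
    using u by (auto simp: Lp_space_def)
  let ?I = "LINT x|lborel. \<bar>u x\<bar>"
  have "ennreal (?I powr p) \<le> ennreal (V powr (p - 1)) * (\<integral>\<^sup>+x. indicator \<Omega> x * ennreal (\<bar>u x\<bar> powr p) \<partial>lborel)"
  proof (rule weighted_power_mean[OF p V(2)])
    have "(\<integral>\<^sup>+x. indicator \<Omega> x * ennreal \<bar>u x\<bar> \<partial>lborel) = (\<integral>\<^sup>+x. ennreal \<bar>u x\<bar> \<partial>lborel)"
      by (intro nn_integral_cong) (use out in \<open>auto split: split_indicator\<close>)
    also have "\<dots> = ennreal ?I" using int by (intro nn_integral_eq_integral) auto
    finally show "(\<integral>\<^sup>+x. indicator \<Omega> x * ennreal \<bar>u x\<bar> \<partial>lborel) = ennreal ?I" .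
  qed (use V in auto)
  also have "(\<integral>\<^sup>+x. indicator \<Omega> x * ennreal (\<bar>u x\<bar> powr p) \<partial>lborel) \<le> (\<integral>\<^sup>+x. ennreal (norm (u x) powr p) \<partial>lborel)"
    by (intro nn_integral_mono) (auto split: split_indicator)
  also have "(\<integral>\<^sup>+x. ennreal (norm (u x) powr p) \<partial>lborel) = ennreal (Lp_norm lborel p u powr p)"
    using p by (subst nn_integral_eq_integral[OF ui]) (auto simp: Lp_norm_powr)
  finally have "ennreal (?I powr p) \<le> ennreal (V powr (p - 1)) * ennreal (Lp_norm lborel p u powr p)"
    by (simp add: mult_left_mono)
  then have "?I powr p \<le> V powr (p - 1) * Lp_norm lborel p u powr p"
    by (simp add: ennreal_mult'[symmetric] ennreal_le_iff)
  also have "\<dots> = (V powr (1 - 1 / p) * Lp_norm lborel p u) powr p"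
  proof -
    have "(1 - 1 / p) * p = p - 1" using p by (simp add: field_simps)
    then show ?thesis by (simp add: powr_mult powr_powr)
  qed
  finally have "\<not> V powr (1 - 1 / p) * Lp_norm lborel p u < ?I"
    using p Lp_norm_nonneg[of lborel p u] powr_less_mono2[of p "V powr (1 - 1 / p) * Lp_norm lborel p u" ?I] by auto
  then show ?thesis by simp
qed

text \<open>The pointwise estimate is used on \<Omega> only, as u vanishes elsewhere; multiplied by
  the indicator of \<Omega>, its constant term becomes a function in L^p. Young's inequality
  controls the other term.\<close>

lemma smooth_estimate:
  fixes u :: "'a::euclidean_space \<Rightarrow> real"
  assumes p: "1 < p" and s: "0 < s" "s < 1" and u: "u \<in> Cc_infinity \<Omega>"
    and \<Omega>: "open \<Omega>" and V: "emeasure lborel \<Omega> \<le> ennreal V" "0 < V"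
    and T: "1 \<le> T" "(4 * pi * T) powr (- real DIM('a) / 2) * V \<le> 1 / 2"
    and G: "\<And>x. x \<in> {1..2} \<Longrightarrow> Gamma x \<le> G"
    and D: "frac_grad_smooth s u \<in> Lp_space lebesgue p"
  shows "Lp_norm lebesgue p u \<le> 4 * G * (real DIM('a) + 1) * T / s * Lp_norm lebesgue p (frac_grad_smooth s u)"
proof -
  obtain M L where htf: "heat_test_function u M L s" using Cc_infinity_heat_test_function[OF u s] by blast
  interpret heat_test_function u M L s by (rule htf)
  define R where "R = (\<lambda>x. enn2real (\<integral>\<^sup>+y. hgrad_mean a T (x - y) * ennreal (norm (D y)) \<partial>lborel))"
  define \<kappa> where "\<kappa> = (n + 1) * T / s"
  have T0: "0 < T" using T by simp
  have \<kappa>: "0 < \<kappa>" using n T0 s by (simp add: \<kappa>_def)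
  have [measurable]: "\<Omega> \<in> sets borel" using \<Omega> by simp
  have out: "u x = 0" if "x \<notin> \<Omega>" for x using Cc_infinity_vanishes[OF u that] .
  have Dl: "D \<in> Lp_space lborel p" using D Lp_lebesgue_eq_lborel(2)[OF D_measurable] by blast
  have mass: "(\<integral>\<^sup>+y. hgrad_mean a T (y::'a) \<partial>lborel) \<le> ennreal \<kappa>"
  proof -
    \<comment> \<open>Here T \<ge> 1 enters: T^(s/2) is replaced by T, which does not depend on
      s.\<close>
    have "T powr (s / 2) \<le> T powr 1" using T s by (intro powr_mono) auto
    then have "(n + 1) / s * T powr (s / 2) \<le> \<kappa>"
      using n s T0 by (simp add: \<kappa>_def divide_right_mono)
    then show ?thesis
      using nn_integral_hgrad_mean[OF s T0, where 'a='a] unfolding a_def n_def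
      by (meson ennreal_leI order.trans)
  qed
  have R: "R \<in> Lp_space lborel p" "Lp_norm lborel p R \<le> \<kappa> * Lp_norm lborel p D"
    unfolding R_def using hgrad_mean_D_finite[OF T0]
    by (auto intro!: Lp_norm_convolution[OF p \<kappa> _ mass Dl])
  have ul: "u \<in> Lp_space lborel p"
  proof -
    have "integrable lborel (\<lambda>x. norm (u x) powr p)"
    proof (rule Bochner_Integration.integrable_bound)
      show "integrable lborel (\<lambda>x. M powr (p - 1) * \<bar>u x\<bar>)" using int_u by simp
      have "norm (u x) powr p \<le> M powr (p - 1) * \<bar>u x\<bar>" for x
      proof -
        have "norm (u x) powr p = norm (u x) powr (p - 1) * norm (u x)"
          using powr_mult_base[of "norm (u x)" "p - 1"] by (simp add: mult.commute)
        also have "\<dots> \<le> M powr (p - 1) * norm (u x)"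
          using bound[of x] p by (intro mult_right_mono powr_mono2) auto
        finally show ?thesis by simp
      qed
      then show "AE x in lborel. norm (norm (u x) powr p) \<le> norm (M powr (p - 1) * \<bar>u x\<bar>)"
        by (simp add: abs_mult)
    qed measurable
    then show ?thesis by (simp add: Lp_space_def)
  qed
  define A where "A = 2 * Gamma (a + 1)"
  \<comment> \<open>a + 1 lies between 1 and 3/2, inside the interval on which \<open>G\<close>
    bounds Gamma.\<close>
  have A: "0 \<le> A" "A \<le> 2 * G"
    using a G[of "a + 1"] Gamma_real_pos[of "a + 1"] by (auto simp: A_def)
  let ?b = "(4 * pi * T) powr (- n / 2) * (LINT z|lborel. \<bar>u z\<bar>)"
  have b: "0 \<le> ?b" by simp
  let ?h = "\<lambda>x. ?b * indicator \<Omega> x"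
  have fin: "emeasure lborel \<Omega> < \<infinity>" using V(1) by (auto intro: le_less_trans)
  have hL: "?h \<in> Lp_space lborel p"
  proof -
    have "integrable lborel (\<lambda>x. indicator \<Omega> x * (?b powr p))"
      using fin by (intro integrable_mult_left integrable_real_indicator) auto
    moreover have "norm (?h x) powr p = indicator \<Omega> x * (?b powr p)" for x
      using b p by (auto split: split_indicator)
    ultimately show ?thesis by (simp add: Lp_space_def)
  qed
  have hN: "Lp_norm lborel p ?h \<le> ?b * V powr (1 / p)"
  proof -
    have "norm (?h x) powr p = indicator \<Omega> x * (?b powr p)" for x
      using b p by (auto split: split_indicator)
    then have "(LINT x|lborel. norm (?h x) powr p) = measure lborel \<Omega> * ?b powr p" by simp
    also have "\<dots> \<le> V * ?b powr p"
      using V by (intro mult_right_mono) (auto simp: measure_def enn2real_leI)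
    also have "\<dots> = (?b * V powr (1 / p)) powr p"
      using p V by (simp add: powr_mult powr_powr)
    finally show ?thesis using p b by (subst Lp_norm_le_iff) auto
  qed
  have "Lp_norm lborel p u \<le> Lp_norm lborel p (\<lambda>x. A * R x + ?h x)"
  proof -
    have sumL: "(\<lambda>x. A * R x + ?h x) \<in> Lp_space lborel p"
      by (intro Lp_space_add p Lp_space_cmult R hL)
    have "norm (u x) powr p \<le> norm (A * R x + ?h x) powr p" for x
    proof (cases "x \<in> \<Omega>")
      case True
      have "norm (u x) \<le> A * R x + ?h x"
        using pointwise_estimate[OF T0, of x] True by (simp add: A_def R_def)
      then show ?thesis using p by (intro powr_mono2) auto
    qed (use out p in simp)
    then have "(LINT x|lborel. norm (u x) powr p) \<le> (LINT x|lborel. norm (A * R x + ?h x) powr p)"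
      using ul sumL by (intro integral_mono) (auto simp: Lp_space_def)
    then show ?thesis using p Lp_norm_nonneg by (subst Lp_norm_le_iff) (auto simp: Lp_norm_powr)
  qed
  also have "\<dots> \<le> Lp_norm lborel p (\<lambda>x. A * R x) + Lp_norm lborel p ?h"
    by (intro Lp_space_add p Lp_space_cmult R hL)
  also have "Lp_norm lborel p (\<lambda>x. A * R x) = A * Lp_norm lborel p R"
    by (rule Lp_norm_cmult[OF p A(1)])
  finally have main: "Lp_norm lborel p u \<le> A * Lp_norm lborel p R + Lp_norm lborel p ?h" .
  \<comment> \<open>V^(1/p) from the constant on \<Omega> and V^(1-1/p) from Hoelder multiply to V,
    so the smallness condition on T does not involve p.\<close>
  have "Lp_norm lborel p ?h \<le> 1 / 2 * Lp_norm lborel p u"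
  proof -
    note hN
    also have "?b * V powr (1 / p) \<le> (4 * pi * T) powr (- n / 2) * (V powr (1 - 1 / p) * Lp_norm lborel p u) * V powr (1 / p)"
      using L1_norm_le_Lp_norm[OF p ul int_u _ V out] by (intro mult_right_mono mult_left_mono) auto
    also have "\<dots> = (4 * pi * T) powr (- n / 2) * (V powr (1 - 1 / p) * V powr (1 / p)) * Lp_norm lborel p u"
      by simp
    also have "V powr (1 - 1 / p) * V powr (1 / p) = V" using V by (simp add: powr_add[symmetric])
    also have "(4 * pi * T) powr (- n / 2) * V * Lp_norm lborel p u \<le> 1 / 2 * Lp_norm lborel p u"
      using T(2) unfolding n_def by (intro mult_right_mono Lp_norm_nonneg)
    finally show ?thesis .
  qed
  with main have "Lp_norm lborel p u \<le> 2 * (A * Lp_norm lborel p R)" by linarith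
  also have "\<dots> \<le> 2 * ((2 * G) * (\<kappa> * Lp_norm lborel p D))"
    using A R by (intro mult_left_mono mult_mono) (auto simp: Lp_norm_nonneg)
  also have "\<dots> = 4 * G * (real DIM('a) + 1) * T / s * Lp_norm lborel p D"
    by (simp add: \<kappa>_def n_def)
  finally show ?thesis
    by (simp add: Lp_lebesgue_eq_lborel(1)[OF borel_u] Lp_lebesgue_eq_lborel(1)[OF D_measurable])
qed

section \<open>Passage to the closure of the test functions\<close>

lemma Lp_norm_minus_commute: "Lp_norm N p (\<lambda>x. f x - g x) = Lp_norm N p (\<lambda>x. g x - f x)"
  by (simp add: Lp_norm_def norm_minus_commute)

lemma Lp_space_diff:
  assumes "1 < p" "f \<in> Lp_space N p" "g \<in> Lp_space N p"
  shows "(\<lambda>x. f x - g x) \<in> Lp_space N p"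
proof -
  have "(\<lambda>x. - g x) \<in> Lp_space N p" using assms(3) by (auto simp: Lp_space_def)
  from Lp_space_add(1)[OF assms(1,2) this] show ?thesis by simp
qed

lemma Lp_norm_triangle_diff:
  assumes "1 < p" "f \<in> Lp_space N p" "g \<in> Lp_space N p"
  shows "Lp_norm N p g \<le> Lp_norm N p f + Lp_norm N p (\<lambda>x. f x - g x)"
  using Lp_space_add(2)[OF assms(1,2) Lp_space_diff[OF assms(1,3,2)]]
  by (simp add: Lp_norm_minus_commute[of N p f g])

lemma Lp_norm_lebesgue_on_le:
  fixes u :: "'a::euclidean_space \<Rightarrow> real"
  assumes "1 < p" "u \<in> Lp_space lebesgue p" "\<Omega> \<in> sets lebesgue"
  shows "Lp_norm (lebesgue_on \<Omega>) p u \<le> Lp_norm lebesgue p u"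
proof -
  have int: "integrable lebesgue (\<lambda>x. norm (u x) powr p)" using assms by (simp add: Lp_space_def)
  have "(LINT x|lebesgue_on \<Omega>. norm (u x) powr p) = (LINT x|lebesgue. indicator \<Omega> x *\<^sub>R norm (u x) powr p)"
    using assms(3) by (subst integral_restrict_space) auto
  also have "\<dots> \<le> (LINT x|lebesgue. norm (u x) powr p)"
    using integrable_mult_indicator[OF assms(3) int]
    by (intro integral_mono int) (auto split: split_indicator)
  finally show ?thesis
    using assms(1) by (subst Lp_norm_le_iff) (auto simp: Lp_norm_powr Lp_norm_nonneg)
qed

text \<open>The estimate for the approximating v_j passes to the limit by the triangle inequality on
  both sides. Membership in \<open>frac_sobolev0\<close> already provides convergence to the
  representative selected by \<open>frac_grad\<close>, so uniqueness of that limit does not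
  enter.\<close>

theorem theorem2p9:
  fixes \<Omega> :: "(real ^ 'n) set"
  assumes "open \<Omega>" and "bounded \<Omega>"
  shows "\<exists>C::real. \<forall>s p :: real. 0 < s \<longrightarrow> s < 1 \<longrightarrow> 1 < p \<longrightarrow>
    (\<forall>u \<in> frac_sobolev0 \<Omega> s p.
       Lp_norm (lebesgue_on \<Omega>) p u \<le> C / s * Lp_norm lebesgue p (frac_grad s p u))"
proof -
  let ?n = "real DIM(real ^ 'n)"
  \<comment> \<open>Adding 1 keeps V positive when \<Omega> is empty.\<close>
  define V where "V = measure lborel \<Omega> + 1"
  have V: "emeasure lborel \<Omega> \<le> ennreal V" "0 < V"
  proof -
    have "emeasure lborel \<Omega> = ennreal (measure lborel \<Omega>)"
      using emeasure_bounded_finite[OF assms(2)] by (intro emeasure_eq_ennreal_measure) auto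
    then show "emeasure lborel \<Omega> \<le> ennreal V" by (simp add: V_def ennreal_leI)
    show "0 < V" by (simp add: V_def add_nonneg_pos)
  qed
  obtain G where G: "\<And>x::real. x \<in> {1..2} \<Longrightarrow> Gamma x \<le> G"
  proof -
    have "compact (Gamma ` {1..2::real})"
      by (intro compact_continuous_image continuous_on_Gamma) (auto elim!: nonpos_Ints_cases)
    then obtain G where "\<forall>y\<in>Gamma ` {1..2::real}. norm y \<le> G"
      using compact_imp_bounded bounded_iff by metis
    then show ?thesis by (intro that[of G]) (auto simp: abs_le_iff)
  qed
  \<comment> \<open>T \<ge> 1 and n \<ge> 1 give (4 \<pi> T)^(-n/2) \<le> T^(-1/2), and the square
    of 2 V makes that at most 1 / (2 V).\<close>
  define T where "T = max 1 ((2 * V)\<^sup>2)"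
  have T: "1 \<le> T" "(4 * pi * T) powr (- ?n / 2) * V \<le> 1 / 2"
  proof -
    show T1: "1 \<le> T" by (simp add: T_def)
    have "T \<le> 4 * pi * T" using T1 pi_gt3 by simp
    moreover have "1 \<le> ?n" by (simp add: Suc_leI)
    ultimately have "(4 * pi * T) powr (- ?n / 2) \<le> T powr (- ?n / 2)" "T powr (- ?n / 2) \<le> T powr (- (1 / 2))"
      using T1 by (auto intro!: powr_mono2' powr_mono)
    then have "(4 * pi * T) powr (- ?n / 2) \<le> T powr (- (1 / 2))" by (rule order.trans)
    also have "\<dots> = 1 / sqrt T" using T1 by (simp add: powr_minus_divide powr_half_sqrt)
    also have "\<dots> \<le> 1 / (2 * V)"
    proof (rule divide_left_mono)
      show "2 * V \<le> sqrt T" by (rule real_le_rsqrt) (simp add: T_def)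
    qed (use V T1 in auto)
    finally have "(4 * pi * T) powr (- ?n / 2) * V \<le> 1 / (2 * V) * V"
      by (rule mult_right_mono) (use V in simp)
    then show "(4 * pi * T) powr (- ?n / 2) * V \<le> 1 / 2" using V by simp
  qed
  \<comment> \<open>The 4 is the 2 in 2 Gamma (a + 1) times the 2 from absorbing half of the
    norm.\<close>
  define C where "C = 4 * G * (?n + 1) * T"
  have C0: "0 \<le> C" using G[of 1] T by (simp add: C_def)
  show ?thesis
  proof (intro exI[of _ C] allI impI ballI)
    fix s p :: real and u assume s: "0 < s" "s < 1" and p: "1 < p" and u: "u \<in> frac_sobolev0 \<Omega> s p"
    let ?g = "frac_grad s p u"
    obtain v where v: "\<And>j. v j \<in> Cc_infinity \<Omega>" and vu: "Lp_tendsto lebesgue p v u"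
      and Dv: "Lp_tendsto lebesgue p (\<lambda>j. frac_grad_smooth s (v j)) ?g"
      using u by (auto simp: frac_sobolev0_def)
    let ?d = "\<lambda>j. Lp_norm lebesgue p (\<lambda>x. v j x - u x)"
    let ?e = "\<lambda>j. Lp_norm lebesgue p (\<lambda>x. frac_grad_smooth s (v j) x - ?g x)"
    have le: "Lp_norm lebesgue p u \<le> C / s * (Lp_norm lebesgue p ?g + ?e j) + ?d j" for j
    proof -
      have L: "v j \<in> Lp_space lebesgue p" "u \<in> Lp_space lebesgue p"
        "frac_grad_smooth s (v j) \<in> Lp_space lebesgue p" "?g \<in> Lp_space lebesgue p"
        using vu Dv by (auto simp: Lp_tendsto_def)
      have "Lp_norm lebesgue p u \<le> Lp_norm lebesgue p (v j) + ?d j"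
        by (rule Lp_norm_triangle_diff[OF p L(1,2)])
      moreover have "Lp_norm lebesgue p (v j) \<le> C / s * Lp_norm lebesgue p (frac_grad_smooth s (v j))"
        unfolding C_def by (rule smooth_estimate[OF p s v assms(1) V T G L(3)])
      moreover have "C / s * Lp_norm lebesgue p (frac_grad_smooth s (v j)) \<le> C / s * (Lp_norm lebesgue p ?g + ?e j)"
      proof (rule mult_left_mono)
        show "Lp_norm lebesgue p (frac_grad_smooth s (v j)) \<le> Lp_norm lebesgue p ?g + ?e j"
          unfolding Lp_norm_minus_commute[of lebesgue p "frac_grad_smooth s (v j)"]
          by (rule Lp_norm_triangle_diff[OF p L(4,3)])
      qed (use C0 s in simp)
      ultimately show ?thesis by linarith
    qed
    have "(\<lambda>j. C / s * (Lp_norm lebesgue p ?g + ?e j) + ?d j) \<longlonglongrightarrow> C / s * (Lp_norm lebesgue p ?g + 0) + 0"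
      using vu Dv by (intro tendsto_intros) (auto simp: Lp_tendsto_def)
    then have "Lp_norm lebesgue p u \<le> C / s * (Lp_norm lebesgue p ?g + 0) + 0"
      by (rule LIMSEQ_le_const) (use le in blast)
    moreover have "Lp_norm (lebesgue_on \<Omega>) p u \<le> Lp_norm lebesgue p u"
      using vu assms(1) p by (intro Lp_norm_lebesgue_on_le) (auto simp: Lp_tendsto_def)
    ultimately show "Lp_norm (lebesgue_on \<Omega>) p u \<le> C / s * Lp_norm lebesgue p ?g" by simp
  qed
qed

end
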